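(* Let $\mathscr A$ be a finitary abelian category with the finite length property. Let $\mathcal S$ be the set of isomorphism classes of simple objects of $\mathscr A$ and suppose that $\mathcal S=\mathcal S_-\sqcup\mathcal S_+$ (disjoint union), where $\mathcal S_-$ (respectively $\mathcal S_+$) is the set of isomorphism classes of projective (respectively injective) simple objects. Let $\mathscr A_\pm=\mathrm{Add}_{\mathscr A}\mathcal S_\pm$ and let $\mathscr A_0$ be the full subcategory of $\mathscr A$ whose objects have no simple direct summands. Then $(\mathscr A_+,\mathscr A_-)$ is a pentagonal pair for $\mathscr A$ with middle term $\mathscr A_0$; that is, $(\mathscr A_+,\mathscr A_-)$ is a factorizing pair for $\mathscr A$, and $\mathscr A_0$ is a full additive subcategory closed under extensions such that $(\mathscr A_-,\mathscr A_0,\mathscr A_+)$ is a factorizing triple for $\mathscr A$.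
   Context: An (essentially small) abelian category is finitary if all $\mathrm{Hom}$ and $\mathrm{Ext}^1$ sets are finite; it has the finite length property if every object has a finite composition series. For a set $\mathcal S$ of isomorphism classes, $\mathrm{Add}_{\mathscr A}\mathcal S$ is the smallest additive full subcategory containing all direct summands of all objects $M$ with $[M]\in\mathcal S$. An ordered pair $(\mathscr A',\mathscr A'')$ of full subcategories closed under extensions is a factorizing pair for $\mathscr A$ if every object $M$ of $\mathscr A$ has a unique subobject $M''$ that is an object of $\mathscr A''$ and such that $M/M''$ is an object of $\mathscr A'$ (the same definition applies with $\mathscr A$ replaced by a full subcategory closed under extensions). A factorizing triple for $\mathscr A$ is $(\mathscr A_1,\mathscr A_2,\mathscr A_3)$ such that $(\mathscr A_1,\mathscr A_2)$ is a factorizing pair for $\mathscr A_{\le2}$, the minimal additive subcategory containing $\mathscr A_1,\mathscr A_2$ and closed under extensions, and $(\mathscr A_{\le2},\mathscr A_3)$ is a factorizing pair for $\mathscr A$. A factorizing pair $(\mathscr A',\mathscr A'')$ is called a pentagonal pair if there is a full additive subcategory $\mathscr A_0$ closed under extensions such that $(\mathscr A'',\mathscr A_0,\mathscr A')$ is a factorizing triple. *)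

theory Defs
  imports "HOL-Algebra.Group"
begin

text \<open>
  Categories are small: objects and arrows form sets in the types \<open>'o\<close> and \<open>'m\<close>. Each arrow carries
  its domain and codomain, and \<open>g \<cdot>\<^bsub>C\<^esub> f\<close> (``\<open>g\<close> after \<open>f\<close>'') is meaningful only if
  \<open>Cod C f = Dom C g\<close>. \<open>Zero C X Y\<close> and \<open>Plus C\<close> are the abelian group operations on Hom-sets.
\<close>

record ('o, 'm) addcat =
  Obj :: "'o set"
  Arr :: "'m set"
  Dom :: "'m \<Rightarrow> 'o"
  Cod :: "'m \<Rightarrow> 'o"
  Id :: "'o \<Rightarrow> 'm"
  Comp :: "'m \<Rightarrow> 'm \<Rightarrow> 'm" (infixl "\<cdot>\<index>" 70)
  Zero :: "'o \<Rightarrow> 'o \<Rightarrow> 'm"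
  Plus :: "'m \<Rightarrow> 'm \<Rightarrow> 'm"

definition homset :: "('o, 'm) addcat \<Rightarrow> 'o \<Rightarrow> 'o \<Rightarrow> 'm set" where
  "homset C X Y = {f \<in> Arr C. Dom C f = X \<and> Cod C f = Y}"

definition homgroup :: "('o, 'm) addcat \<Rightarrow> 'o \<Rightarrow> 'o \<Rightarrow> 'm monoid" where
  "homgroup C X Y = \<lparr>carrier = homset C X Y, mult = Plus C, one = Zero C X Y\<rparr>"

locale category =
  fixes C :: "('o, 'm) addcat" (structure)
  assumes Dom_closed: "f \<in> Arr C \<Longrightarrow> Dom C f \<in> Obj C"
    and Cod_closed: "f \<in> Arr C \<Longrightarrow> Cod C f \<in> Obj C"
    and Id_closed: "X \<in> Obj C \<Longrightarrow> Id C X \<in> homset C X X"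
    and Comp_closed: "\<lbrakk>f \<in> homset C X Y; g \<in> homset C Y Z\<rbrakk> \<Longrightarrow> g \<cdot> f \<in> homset C X Z"
    and Id_left: "f \<in> homset C X Y \<Longrightarrow> Id C Y \<cdot> f = f"
    and Id_right: "f \<in> homset C X Y \<Longrightarrow> f \<cdot> Id C X = f"
    and Comp_assoc: "\<lbrakk>f \<in> homset C W X; g \<in> homset C X Y; h \<in> homset C Y Z\<rbrakk>
          \<Longrightarrow> (h \<cdot> g) \<cdot> f = h \<cdot> (g \<cdot> f)"

locale preadditive_category = category +
  assumes homgroup: "\<lbrakk>X \<in> Obj C; Y \<in> Obj C\<rbrakk> \<Longrightarrow> comm_group (homgroup C X Y)"
    and Comp_Plus_left: "\<lbrakk>f \<in> homset C X Y; g \<in> homset C Y Z; g' \<in> homset C Y Z\<rbrakk>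
          \<Longrightarrow> Plus C g g' \<cdot> f = Plus C (g \<cdot> f) (g' \<cdot> f)"
    and Comp_Plus_right: "\<lbrakk>f \<in> homset C X Y; f' \<in> homset C X Y; g \<in> homset C Y Z\<rbrakk>
          \<Longrightarrow> g \<cdot> Plus C f f' = Plus C (g \<cdot> f) (g \<cdot> f')"

definition zero_object :: "('o, 'm) addcat \<Rightarrow> 'o \<Rightarrow> bool" where
  "zero_object C Z \<longleftrightarrow> Z \<in> Obj C \<and>
     (\<forall>X\<in>Obj C. (\<exists>!f. f \<in> homset C X Z) \<and> (\<exists>!f. f \<in> homset C Z X))"

definition monic :: "('o, 'm) addcat \<Rightarrow> 'm \<Rightarrow> bool" where
  "monic C f \<longleftrightarrow> f \<in> Arr C \<and>
     (\<forall>X\<in>Obj C. \<forall>g\<in>homset C X (Dom C f). \<forall>h\<in>homset C X (Dom C f).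
        f \<cdot>\<^bsub>C\<^esub> g = f \<cdot>\<^bsub>C\<^esub> h \<longrightarrow> g = h)"

definition epic :: "('o, 'm) addcat \<Rightarrow> 'm \<Rightarrow> bool" where
  "epic C f \<longleftrightarrow> f \<in> Arr C \<and>
     (\<forall>X\<in>Obj C. \<forall>g\<in>homset C (Cod C f) X. \<forall>h\<in>homset C (Cod C f) X.
        g \<cdot>\<^bsub>C\<^esub> f = h \<cdot>\<^bsub>C\<^esub> f \<longrightarrow> g = h)"

definition iso_arrow :: "('o, 'm) addcat \<Rightarrow> 'm \<Rightarrow> bool" where
  "iso_arrow C f \<longleftrightarrow> f \<in> Arr C \<and>
     (\<exists>g\<in>homset C (Cod C f) (Dom C f).
        g \<cdot>\<^bsub>C\<^esub> f = Id C (Dom C f) \<and> f \<cdot>\<^bsub>C\<^esub> g = Id C (Cod C f))"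

definition isomorphic :: "('o, 'm) addcat \<Rightarrow> 'o \<Rightarrow> 'o \<Rightarrow> bool" where
  "isomorphic C X Y \<longleftrightarrow> (\<exists>f\<in>homset C X Y. iso_arrow C f)"

definition iso_class :: "('o, 'm) addcat \<Rightarrow> 'o \<Rightarrow> 'o set" where
  "iso_class C X = {Y \<in> Obj C. isomorphic C X Y}"

definition is_kernel :: "('o, 'm) addcat \<Rightarrow> 'm \<Rightarrow> 'm \<Rightarrow> bool" where
  "is_kernel C k f \<longleftrightarrow> k \<in> Arr C \<and> f \<in> Arr C \<and> Cod C k = Dom C f \<and>
     f \<cdot>\<^bsub>C\<^esub> k = Zero C (Dom C k) (Cod C f) \<and>
     (\<forall>h\<in>Arr C. Cod C h = Dom C f \<and> f \<cdot>\<^bsub>C\<^esub> h = Zero C (Dom C h) (Cod C f) \<longrightarrow>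
        (\<exists>!u. u \<in> homset C (Dom C h) (Dom C k) \<and> k \<cdot>\<^bsub>C\<^esub> u = h))"

definition is_cokernel :: "('o, 'm) addcat \<Rightarrow> 'm \<Rightarrow> 'm \<Rightarrow> bool" where
  "is_cokernel C p f \<longleftrightarrow> p \<in> Arr C \<and> f \<in> Arr C \<and> Dom C p = Cod C f \<and>
     p \<cdot>\<^bsub>C\<^esub> f = Zero C (Dom C f) (Cod C p) \<and>
     (\<forall>h\<in>Arr C. Dom C h = Cod C f \<and> h \<cdot>\<^bsub>C\<^esub> f = Zero C (Dom C f) (Cod C h) \<longrightarrow>
        (\<exists>!u. u \<in> homset C (Cod C p) (Cod C h) \<and> u \<cdot>\<^bsub>C\<^esub> p = h))"

definition is_biproduct ::
  "('o, 'm) addcat \<Rightarrow> 'o \<Rightarrow> 'o \<Rightarrow> 'o \<Rightarrow> 'm \<Rightarrow> 'm \<Rightarrow> 'm \<Rightarrow> 'm \<Rightarrow> bool" where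
  "is_biproduct C X Y B i j p q \<longleftrightarrow>
     X \<in> Obj C \<and> Y \<in> Obj C \<and> B \<in> Obj C \<and>
     i \<in> homset C X B \<and> j \<in> homset C Y B \<and> p \<in> homset C B X \<and> q \<in> homset C B Y \<and>
     p \<cdot>\<^bsub>C\<^esub> i = Id C X \<and> q \<cdot>\<^bsub>C\<^esub> j = Id C Y \<and>
     p \<cdot>\<^bsub>C\<^esub> j = Zero C Y X \<and> q \<cdot>\<^bsub>C\<^esub> i = Zero C X Y \<and>
     Plus C (i \<cdot>\<^bsub>C\<^esub> p) (j \<cdot>\<^bsub>C\<^esub> q) = Id C B"

definition direct_sum :: "('o, 'm) addcat \<Rightarrow> 'o \<Rightarrow> 'o \<Rightarrow> 'o \<Rightarrow> bool" where
  "direct_sum C X Y B \<longleftrightarrow> (\<exists>i j p q. is_biproduct C X Y B i j p q)"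

definition direct_summand :: "('o, 'm) addcat \<Rightarrow> 'o \<Rightarrow> 'o \<Rightarrow> bool" where
  "direct_summand C X B \<longleftrightarrow> (\<exists>Y. direct_sum C X Y B)"

locale abelian_category = preadditive_category +
  assumes ex_zero_object: "\<exists>Z. zero_object C Z"
    and ex_direct_sum: "\<lbrakk>X \<in> Obj C; Y \<in> Obj C\<rbrakk> \<Longrightarrow> \<exists>B. direct_sum C X Y B"
    and ex_kernel: "f \<in> Arr C \<Longrightarrow> \<exists>k. is_kernel C k f"
    and ex_cokernel: "f \<in> Arr C \<Longrightarrow> \<exists>p. is_cokernel C p f"
    and monic_normal: "monic C k \<Longrightarrow> \<exists>f. is_kernel C k f"
    and epic_normal: "epic C p \<Longrightarrow> \<exists>f. is_cokernel C p f"

definition short_exact :: "('o, 'm) addcat \<Rightarrow> 'm \<Rightarrow> 'm \<Rightarrow> bool" where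
  "short_exact C f g \<longleftrightarrow> is_kernel C f g \<and> is_cokernel C g f"

text \<open>\<open>Ext1 C X Y\<close> is the Yoneda \<open>Ext\<^sup>1(X, Y)\<close>: classes of short exact sequences
  \<open>0 \<rightarrow> Y \<rightarrow> E \<rightarrow> X \<rightarrow> 0\<close>.\<close>

definition extensions :: "('o, 'm) addcat \<Rightarrow> 'o \<Rightarrow> 'o \<Rightarrow> ('m \<times> 'm) set" where
  "extensions C X Y = {(f, g). short_exact C f g \<and> Dom C f = Y \<and> Cod C g = X}"

definition ext_equiv :: "('o, 'm) addcat \<Rightarrow> 'o \<Rightarrow> 'o \<Rightarrow> (('m \<times> 'm) \<times> ('m \<times> 'm)) set" where
  "ext_equiv C X Y = {((f, g), (f', g')).
     (f, g) \<in> extensions C X Y \<and> (f', g') \<in> extensions C X Y \<and>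
     (\<exists>h\<in>homset C (Cod C f) (Cod C f'). iso_arrow C h \<and> h \<cdot>\<^bsub>C\<^esub> f = f' \<and> g' \<cdot>\<^bsub>C\<^esub> h = g)}"

definition Ext1 :: "('o, 'm) addcat \<Rightarrow> 'o \<Rightarrow> 'o \<Rightarrow> ('m \<times> 'm) set set" where
  "Ext1 C X Y = extensions C X Y // ext_equiv C X Y"

locale finitary_abelian_category = abelian_category +
  assumes finite_hom: "\<lbrakk>X \<in> Obj C; Y \<in> Obj C\<rbrakk> \<Longrightarrow> finite (homset C X Y)"
    and finite_Ext1: "\<lbrakk>X \<in> Obj C; Y \<in> Obj C\<rbrakk> \<Longrightarrow> finite (Ext1 C X Y)"

definition projective :: "('o, 'm) addcat \<Rightarrow> 'o \<Rightarrow> bool" where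
  "projective C P \<longleftrightarrow> P \<in> Obj C \<and>
     (\<forall>e. epic C e \<longrightarrow> (\<forall>f\<in>homset C P (Cod C e). \<exists>g\<in>homset C P (Dom C e). e \<cdot>\<^bsub>C\<^esub> g = f))"

definition injective :: "('o, 'm) addcat \<Rightarrow> 'o \<Rightarrow> bool" where
  "injective C I \<longleftrightarrow> I \<in> Obj C \<and>
     (\<forall>m. monic C m \<longrightarrow> (\<forall>f\<in>homset C (Dom C m) I. \<exists>g\<in>homset C (Cod C m) I. g \<cdot>\<^bsub>C\<^esub> m = f))"

definition simple :: "('o, 'm) addcat \<Rightarrow> 'o \<Rightarrow> bool" where
  "simple C X \<longleftrightarrow> X \<in> Obj C \<and> \<not> zero_object C X \<and>
     (\<forall>i. monic C i \<and> Cod C i = X \<longrightarrow> zero_object C (Dom C i) \<or> iso_arrow C i)"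

text \<open>A subobject of \<open>M\<close> is an equivalence class of monomorphisms into \<open>M\<close>.\<close>

definition monos_into :: "('o, 'm) addcat \<Rightarrow> 'o \<Rightarrow> 'm set" where
  "monos_into C M = {i. monic C i \<and> Cod C i = M}"

definition sub_equiv :: "('o, 'm) addcat \<Rightarrow> 'o \<Rightarrow> ('m \<times> 'm) set" where
  "sub_equiv C M = {(i, j). i \<in> monos_into C M \<and> j \<in> monos_into C M \<and>
     (\<exists>u\<in>homset C (Dom C i) (Dom C j). iso_arrow C u \<and> j \<cdot>\<^bsub>C\<^esub> u = i)}"

definition subobjects :: "('o, 'm) addcat \<Rightarrow> 'o \<Rightarrow> 'm set set" where
  "subobjects C M = monos_into C M // sub_equiv C M"

text \<open>A composition series \<open>0 = M\<^sub>0 \<subseteq> \<dots> \<subseteq> M\<^sub>n = M\<close>: \<open>i k\<close> represents the subobject \<open>M\<^sub>k\<close>, and \<open>u\<close> is the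
  inclusion of \<open>M\<^sub>k\<close> in \<open>M\<^sub>k\<^sub>+\<^sub>1\<close>.\<close>

definition composition_series :: "('o, 'm) addcat \<Rightarrow> 'o \<Rightarrow> nat \<Rightarrow> (nat \<Rightarrow> 'm) \<Rightarrow> bool" where
  "composition_series C M n i \<longleftrightarrow>
     (\<forall>k\<le>n. i k \<in> monos_into C M) \<and> zero_object C (Dom C (i 0)) \<and> iso_arrow C (i n) \<and>
     (\<forall>k<n. \<exists>u\<in>homset C (Dom C (i k)) (Dom C (i (Suc k))).
        i (Suc k) \<cdot>\<^bsub>C\<^esub> u = i k \<and> (\<exists>p. is_cokernel C p u \<and> simple C (Cod C p)))"

definition finite_length_property :: "('o, 'm) addcat \<Rightarrow> bool" where
  "finite_length_property C \<longleftrightarrow> (\<forall>M\<in>Obj C. \<exists>n i. composition_series C M n i)"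

text \<open>A full subcategory is given by its set of objects, taken to be closed under isomorphism.\<close>

definition full_subcat :: "('o, 'm) addcat \<Rightarrow> 'o set \<Rightarrow> bool" where
  "full_subcat C P \<longleftrightarrow> P \<subseteq> Obj C \<and> (\<forall>X\<in>P. \<forall>Y\<in>Obj C. isomorphic C X Y \<longrightarrow> Y \<in> P)"

definition additive_subcat :: "('o, 'm) addcat \<Rightarrow> 'o set \<Rightarrow> bool" where
  "additive_subcat C P \<longleftrightarrow> full_subcat C P \<and> (\<forall>Z. zero_object C Z \<longrightarrow> Z \<in> P) \<and>
     (\<forall>X\<in>P. \<forall>Y\<in>P. \<forall>B. direct_sum C X Y B \<longrightarrow> B \<in> P)"

definition ext_closed :: "('o, 'm) addcat \<Rightarrow> 'o set \<Rightarrow> bool" where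
  "ext_closed C P \<longleftrightarrow>
     (\<forall>f g. short_exact C f g \<and> Dom C f \<in> P \<and> Cod C g \<in> P \<longrightarrow> Cod C f \<in> P)"

definition Add_subcat :: "('o, 'm) addcat \<Rightarrow> 'o set set \<Rightarrow> 'o set" where
  "Add_subcat C S = \<Inter>{P. additive_subcat C P \<and>
     (\<forall>M\<in>Obj C. iso_class C M \<in> S \<longrightarrow> (\<forall>N. direct_summand C N M \<longrightarrow> N \<in> P))}"

definition ext_generated :: "('o, 'm) addcat \<Rightarrow> 'o set \<Rightarrow> 'o set \<Rightarrow> 'o set" where
  "ext_generated C A1 A2 =
     \<Inter>{P. additive_subcat C P \<and> ext_closed C P \<and> A1 \<subseteq> P \<and> A2 \<subseteq> P}"

text \<open>\<open>factorizing_pair C B A' A''\<close>: the pair \<open>(A', A'')\<close> is factorizing for the extension-closed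
  full subcategory \<open>B\<close>; the case of the whole category is \<open>B = Obj C\<close>. Subobjects and quotients
  are always those of the ambient abelian category.\<close>

definition factorizing_pair :: "('o, 'm) addcat \<Rightarrow> 'o set \<Rightarrow> 'o set \<Rightarrow> 'o set \<Rightarrow> bool" where
  "factorizing_pair C B A' A'' \<longleftrightarrow>
     full_subcat C B \<and> ext_closed C B \<and>
     full_subcat C A' \<and> ext_closed C A' \<and> A' \<subseteq> B \<and>
     full_subcat C A'' \<and> ext_closed C A'' \<and> A'' \<subseteq> B \<and>
     (\<forall>M\<in>B. \<exists>!U. U \<in> subobjects C M \<and>
        (\<exists>i\<in>U. Dom C i \<in> A'' \<and> (\<exists>p. is_cokernel C p i \<and> Cod C p \<in> A')))"

definition factorizing_triple :: "('o, 'm) addcat \<Rightarrow> 'o set \<Rightarrow> 'o set \<Rightarrow> 'o set \<Rightarrow> bool" where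
  "factorizing_triple C A1 A2 A3 \<longleftrightarrow>
     factorizing_pair C (ext_generated C A1 A2) A1 A2 \<and>
     factorizing_pair C (Obj C) (ext_generated C A1 A2) A3"

definition pentagonal_middle :: "('o, 'm) addcat \<Rightarrow> 'o set \<Rightarrow> 'o set \<Rightarrow> 'o set \<Rightarrow> bool" where
  "pentagonal_middle C A' A'' A0 \<longleftrightarrow>
     additive_subcat C A0 \<and> ext_closed C A0 \<and> factorizing_triple C A'' A0 A'"

definition pentagonal_pair :: "('o, 'm) addcat \<Rightarrow> 'o set \<Rightarrow> 'o set \<Rightarrow> bool" where
  "pentagonal_pair C A' A'' \<longleftrightarrow>
     factorizing_pair C (Obj C) A' A'' \<and> (\<exists>A0. pentagonal_middle C A' A'' A0)"

end

(* The hypotheses force Hom(P, I) = Hom(I, P) = 0 for P a projective and I an injective simple object.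
   A nonzero map from M to P, or from I to M, splits off a direct summand; hence A0 consists of the
   objects M with Hom(M, P) = 0 = Hom(I, M) for all such P and I, which makes it closed under
   extensions.  Splitting off simple summands strictly decreases the finite number card (End M), so
   every M is an extension of an object of Aminus by one without nonzero maps to projective simples,
   and dually.  This yields the factorizing triple, and Hom-orthogonality yields uniqueness of the
   subobjects.  That (Aplus, Aminus) is factorizing follows by induction along a composition series:
   a projective top factor lifts and joins the subobject, while an injective one joins the quotient,
   whose injectivity makes the extension split.  Dual statements are obtained from the opposite category. *)

theory Submission
  imports Defs
begin

text \<open>Disjointness of the two sets of classes says that no projective simple is isomorphic to
  an injective one, so Schur's lemma kills the arrows in both directions. The recurring obstacle is
  to pass from an exact sequence \<open>0 \<rightarrow> A \<rightarrow> U \<rightarrow> B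
  \<rightarrow> 0\<close> for a subobject \<open>U\<close> of \<open>M\<close> with
  \<open>M / U = S\<close> to one for \<open>M\<close>: in general \<open>M / A\<close> is merely an
  extension of \<open>S\<close> by \<open>B\<close>. Once \<open>U \<rightarrow> B\<close> extends
  to \<open>M\<close>, the extended arrow and \<open>M \<rightarrow> S\<close> together form an epic
  arrow from \<open>M\<close> to \<open>B \<oplus> S\<close> with kernel \<open>A\<close>. A
  retraction of \<open>M\<close> onto \<open>U\<close> or injectivity of \<open>B\<close> supplies
  the extended arrow; the dual form enlarges \<open>A\<close> instead of \<open>B\<close>. The
  second obstacle is that \<open>Add_subcat\<close> and \<open>ext_generated\<close> are
  intersections, whose members have no explicit description. They are controlled by bounding them
  with Hom-orthogonal classes; in particular the subcategory generated by Aminus and A0 turns out to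
  be the right orthogonal of the injective simples.\<close>

section \<open>Arrow calculus\<close>

lemma in_homset: "f \<in> homset C X Y \<longleftrightarrow> f \<in> Arr C \<and> Dom C f = X \<and> Cod C f = Y"
  by (simp add: homset_def)

context category
begin

declare Dom_closed [simp] Cod_closed [simp]

lemma Id_simps [simp]:
  assumes "X \<in> Obj C"
  shows "Id C X \<in> Arr C" "Dom C (Id C X) = X" "Cod C (Id C X) = X"
  using Id_closed[OF assms] by (simp_all add: in_homset)

lemma Comp_simps [simp]:
  assumes "f \<in> Arr C" "g \<in> Arr C" "Cod C f = Dom C g"
  shows "g \<cdot> f \<in> Arr C" "Dom C (g \<cdot> f) = Dom C f" "Cod C (g \<cdot> f) = Cod C g"
  using Comp_closed[of f "Dom C f" "Cod C f" g "Cod C g"] assms by (simp_all add: in_homset)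

lemma Comp_Id_left [simp]: "f \<in> Arr C \<Longrightarrow> Cod C f = Y \<Longrightarrow> Id C Y \<cdot> f = f"
  using Id_left[of f "Dom C f"] by (simp add: in_homset)

lemma Comp_Id_right [simp]: "f \<in> Arr C \<Longrightarrow> Dom C f = X \<Longrightarrow> f \<cdot> Id C X = f"
  using Id_right[of f X "Cod C f"] by (simp add: in_homset)

lemma assoc [simp]:
  assumes "f \<in> Arr C" "g \<in> Arr C" "h \<in> Arr C" "Cod C f = Dom C g" "Cod C g = Dom C h"
  shows "(h \<cdot> g) \<cdot> f = h \<cdot> (g \<cdot> f)"
  using assms Comp_assoc by (simp add: in_homset)

text \<open>Rewriting with \<open>assoc\<close> nests composites to the right and so hides a known
  composite \<open>h \<cdot> g\<close> inside \<open>h \<cdot> (g \<cdot> f)\<close>. A fact put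
  into the first premise becomes a rewrite rule for the nested term.\<close>

lemma reassoc:
  assumes "h \<cdot> g = k" "f \<in> Arr C" "g \<in> Arr C" "h \<in> Arr C" "Cod C f = Dom C g" "Cod C g = Dom C h"
  shows "h \<cdot> (g \<cdot> f) = k \<cdot> f"
  using assms assoc by metis

lemma iso_arrowE:
  assumes "iso_arrow C f"
  obtains g where "f \<in> Arr C" "g \<in> Arr C" "Dom C g = Cod C f" "Cod C g = Dom C f"
    "g \<cdot> f = Id C (Dom C f)" "f \<cdot> g = Id C (Cod C f)"
  using assms by (auto simp: iso_arrow_def in_homset)

lemma iso_arrowI:
  assumes "f \<in> Arr C" "g \<in> Arr C" "Dom C g = Cod C f" "Cod C g = Dom C f"
    "g \<cdot> f = Id C (Dom C f)" "f \<cdot> g = Id C (Cod C f)"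
  shows "iso_arrow C f"
  using assms by (auto simp: iso_arrow_def in_homset)

lemma iso_arrow_Id: "X \<in> Obj C \<Longrightarrow> iso_arrow C (Id C X)"
  by (rule iso_arrowI[of _ "Id C X"]) simp_all

lemma iso_arrow_Comp:
  assumes "iso_arrow C f" "iso_arrow C g" "Cod C f = Dom C g"
  shows "iso_arrow C (g \<cdot> f)"
proof -
  obtain f' where f: "f \<in> Arr C" "f' \<in> Arr C" "Dom C f' = Cod C f" "Cod C f' = Dom C f"
    "f' \<cdot> f = Id C (Dom C f)" "f \<cdot> f' = Id C (Cod C f)" by (rule iso_arrowE[OF assms(1)])
  obtain g' where g: "g \<in> Arr C" "g' \<in> Arr C" "Dom C g' = Cod C g" "Cod C g' = Dom C g"
    "g' \<cdot> g = Id C (Dom C g)" "g \<cdot> g' = Id C (Cod C g)" by (rule iso_arrowE[OF assms(2)])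
  show ?thesis
    using f g assms(3) by (intro iso_arrowI[of _ "f' \<cdot> g'"])
      (simp_all add: reassoc[OF g(5)] reassoc[OF f(6)])
qed

lemma isomorphic_refl: "X \<in> Obj C \<Longrightarrow> isomorphic C X X"
  unfolding isomorphic_def by (rule bexI[of _ "Id C X"]) (simp_all add: iso_arrow_Id in_homset)

lemma isomorphic_sym:
  assumes "isomorphic C X Y"
  shows "isomorphic C Y X"
proof -
  obtain f where f: "Dom C f = X" "Cod C f = Y" "iso_arrow C f"
    using assms by (auto simp: isomorphic_def in_homset)
  obtain g where g: "f \<in> Arr C" "g \<in> Arr C" "Dom C g = Cod C f" "Cod C g = Dom C f"
    "g \<cdot> f = Id C (Dom C f)" "f \<cdot> g = Id C (Cod C f)" by (rule iso_arrowE[OF f(3)])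
  have "iso_arrow C g" using f g by (intro iso_arrowI[of g f]) simp_all
  with f g have "g \<in> homset C Y X \<and> iso_arrow C g" by (simp add: in_homset)
  then show ?thesis unfolding isomorphic_def by blast
qed

lemma isomorphic_trans:
  assumes "isomorphic C X Y" "isomorphic C Y Z"
  shows "isomorphic C X Z"
proof -
  obtain f g where f: "f \<in> homset C X Y" "iso_arrow C f" and g: "g \<in> homset C Y Z" "iso_arrow C g"
    using assms by (auto simp: isomorphic_def)
  then have "iso_arrow C (g \<cdot> f)" by (simp add: in_homset iso_arrow_Comp)
  with Comp_closed[OF f(1) g(1)] show ?thesis unfolding isomorphic_def by blast
qed

lemma isomorphic_Obj: "isomorphic C X Y \<Longrightarrow> X \<in> Obj C \<and> Y \<in> Obj C"
  by (auto simp: isomorphic_def in_homset)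

lemma iso_class_eqD:
  "iso_class C X = iso_class C Y \<Longrightarrow> Y \<in> Obj C \<Longrightarrow> isomorphic C X Y"
  unfolding iso_class_def using isomorphic_refl by blast

lemma iso_class_eqI: "isomorphic C X Y \<Longrightarrow> iso_class C X = iso_class C Y"
  unfolding iso_class_def using isomorphic_trans isomorphic_sym by blast

text \<open>Subobjects are the classes of this relation, so uniqueness of a subobject becomes a
  statement about two monic arrows.\<close>

lemma equiv_sub_equiv: "equiv (monos_into C M) (sub_equiv C M)"
proof (rule equivI)
  show "sub_equiv C M \<subseteq> monos_into C M \<times> monos_into C M"
    by (auto simp: sub_equiv_def)
  show "refl_on (monos_into C M) (sub_equiv C M)"
  proof (rule refl_onI)
    fix i assume i: "i \<in> monos_into C M"
    then have "i \<in> Arr C" by (simp add: monos_into_def monic_def)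
    then have "Id C (Dom C i) \<in> homset C (Dom C i) (Dom C i)" "iso_arrow C (Id C (Dom C i))"
      "i \<cdot> Id C (Dom C i) = i" by (simp_all add: in_homset iso_arrow_Id)
    with i show "(i, i) \<in> sub_equiv C M"
      unfolding sub_equiv_def by blast
  qed
  show "sym (sub_equiv C M)"
  proof (rule symI)
    fix i j assume ij: "(i, j) \<in> sub_equiv C M"
    then obtain u where u: "u \<in> Arr C" "Dom C u = Dom C i" "Cod C u = Dom C j" "iso_arrow C u"
      "j \<cdot> u = i" and mono: "i \<in> monos_into C M" "j \<in> monos_into C M"
      by (auto simp: sub_equiv_def in_homset)
    have arr: "i \<in> Arr C" "j \<in> Arr C" using mono by (auto simp: monos_into_def monic_def)
    obtain v where v: "v \<in> Arr C" "Dom C v = Cod C u" "Cod C v = Dom C u"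
      "v \<cdot> u = Id C (Dom C u)" "u \<cdot> v = Id C (Cod C u)" by (rule iso_arrowE[OF u(4)])
    have "i \<cdot> v = j \<cdot> (u \<cdot> v)"
      by (rule reassoc[OF u(5), symmetric]) (use u v arr in simp_all)
    also have "\<dots> = j" using u(3) arr by (simp add: v(5))
    finally have "i \<cdot> v = j" .
    moreover have "iso_arrow C v" using u v by (intro iso_arrowI[of _ u]) simp_all
    ultimately show "(j, i) \<in> sub_equiv C M"
      using mono u v by (auto simp: sub_equiv_def in_homset)
  qed
  show "trans (sub_equiv C M)"
  proof (rule transI)
    fix i j k assume "(i, j) \<in> sub_equiv C M" "(j, k) \<in> sub_equiv C M"
    then obtain u v where u: "u \<in> Arr C" "Dom C u = Dom C i" "Cod C u = Dom C j" "iso_arrow C u"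
      "j \<cdot> u = i" and v: "v \<in> Arr C" "Dom C v = Dom C j" "Cod C v = Dom C k" "iso_arrow C v"
      "k \<cdot> v = j" and mono: "i \<in> monos_into C M" "k \<in> monos_into C M"
      by (auto simp: sub_equiv_def in_homset)
    have "k \<in> Arr C" using mono by (auto simp: monos_into_def monic_def)
    then have "k \<cdot> (v \<cdot> u) = i" "v \<cdot> u \<in> homset C (Dom C i) (Dom C k)" "iso_arrow C (v \<cdot> u)"
      using u v by (simp_all add: reassoc[OF v(5)] in_homset iso_arrow_Comp)
    then show "(i, k) \<in> sub_equiv C M"
      using mono unfolding sub_equiv_def by blast
  qed
qed

end

context preadditive_category
begin

text \<open>\<open>Zero\<close> is constrained only as the unit of \<open>homgroup\<close>; its
  domain and codomain are read off from the fact that the unit lies in the carrier.\<close>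

lemma Zero_simps [simp]:
  assumes "X \<in> Obj C" "Y \<in> Obj C"
  shows "Zero C X Y \<in> Arr C" "Dom C (Zero C X Y) = X" "Cod C (Zero C X Y) = Y"
proof -
  interpret comm_group "homgroup C X Y" using homgroup assms .
  show "Zero C X Y \<in> Arr C" "Dom C (Zero C X Y) = X" "Cod C (Zero C X Y) = Y"
    using one_closed by (simp_all add: homgroup_def in_homset)
qed

lemma Plus_simps [simp]:
  assumes "f \<in> Arr C" "g \<in> Arr C" "Dom C f = Dom C g" "Cod C f = Cod C g"
  shows "Plus C f g \<in> Arr C" "Dom C (Plus C f g) = Dom C f" "Cod C (Plus C f g) = Cod C f"
proof -
  interpret comm_group "homgroup C (Dom C f) (Cod C f)" using homgroup assms by simp
  show "Plus C f g \<in> Arr C" "Dom C (Plus C f g) = Dom C f" "Cod C (Plus C f g) = Cod C f"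
    using m_closed[of f g] assms by (simp_all add: homgroup_def in_homset)
qed

lemma Plus_Zero [simp]:
  assumes "f \<in> Arr C" "Dom C f = X" "Cod C f = Y"
  shows "Plus C f (Zero C X Y) = f" "Plus C (Zero C X Y) f = f"
proof -
  interpret comm_group "homgroup C X Y" using homgroup assms by auto
  show "Plus C f (Zero C X Y) = f" "Plus C (Zero C X Y) f = f"
    using r_one[of f] l_one[of f] assms by (simp_all add: homgroup_def in_homset)
qed

lemma Plus_commute:
  assumes "f \<in> Arr C" "g \<in> Arr C" "Dom C f = Dom C g" "Cod C f = Cod C g"
  shows "Plus C f g = Plus C g f"
proof -
  interpret comm_group "homgroup C (Dom C f) (Cod C f)" using homgroup assms by simp
  show ?thesis using m_comm[of f g] assms by (simp add: homgroup_def in_homset)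
qed

lemma Plus_left_cancel:
  assumes "f \<in> Arr C" "g \<in> Arr C" "h \<in> Arr C" "Dom C f = Dom C g" "Cod C f = Cod C g"
    "Dom C f = Dom C h" "Cod C f = Cod C h" "Plus C f g = Plus C f h"
  shows "g = h"
proof -
  interpret comm_group "homgroup C (Dom C f) (Cod C f)" using homgroup assms by simp
  have "f \<otimes>\<^bsub>homgroup C (Dom C f) (Cod C f)\<^esub> g = f \<otimes>\<^bsub>homgroup C (Dom C f) (Cod C f)\<^esub> h"
    using assms(8) by (simp add: homgroup_def)
  then show ?thesis
    using Units_l_cancel[of f g h] assms(1-7) unfolding Units_eq by (simp add: homgroup_def in_homset)
qed

text \<open>Differences, in the form used to turn an equation \<open>f = g\<close> into \<open>d = 0\<close>.\<close>

lemma ex_difference: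
  assumes "f \<in> Arr C" "g \<in> Arr C" "Dom C f = Dom C g" "Cod C f = Cod C g"
  obtains d where "d \<in> Arr C" "Dom C d = Dom C g" "Cod C d = Cod C g" "Plus C g d = f"
proof -
  interpret comm_group "homgroup C (Dom C f) (Cod C f)" using homgroup assms by simp
  \<comment> \<open>In additive notation this is \<open>- g + f\<close>.\<close>
  let ?d = "inv\<^bsub>homgroup C (Dom C f) (Cod C f)\<^esub> g \<otimes>\<^bsub>homgroup C (Dom C f) (Cod C f)\<^esub> f"
  have c: "f \<in> carrier (homgroup C (Dom C f) (Cod C f))"
    "g \<in> carrier (homgroup C (Dom C f) (Cod C f))"
    using assms by (simp_all add: homgroup_def in_homset)
  then have "?d \<in> carrier (homgroup C (Dom C f) (Cod C f))" by simp
  moreover have "g \<otimes>\<^bsub>homgroup C (Dom C f) (Cod C f)\<^esub> ?d = f"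
    using c by (simp flip: m_assoc)
  ultimately show thesis
    using that[of ?d] assms by (simp add: homgroup_def in_homset)
qed

lemma Comp_Plus_distrib [simp]:
  assumes "f \<in> Arr C" "g \<in> Arr C" "h \<in> Arr C" "Dom C f = Dom C g" "Cod C f = Cod C g"
  shows "Dom C h = Cod C f \<Longrightarrow> h \<cdot> Plus C f g = Plus C (h \<cdot> f) (h \<cdot> g)"
    "Cod C h = Dom C f \<Longrightarrow> Plus C f g \<cdot> h = Plus C (f \<cdot> h) (g \<cdot> h)"
  using assms Comp_Plus_left[of h "Dom C h" "Dom C f" f "Cod C f" g]
    Comp_Plus_right[of f "Dom C f" "Cod C f" g h "Cod C h"] by (simp_all add: in_homset)

text \<open>By distributivity \<open>f \<cdot> 0\<close> equals its own double, and cancellation in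
  the Hom-group leaves zero.\<close>

lemma Comp_Zero_right [simp]:
  assumes "f \<in> Arr C" "Dom C f = Y" "X \<in> Obj C"
  shows "f \<cdot> Zero C X Y = Zero C X (Cod C f)"
proof (rule Plus_left_cancel[of "f \<cdot> Zero C X Y"])
  have "Plus C (f \<cdot> Zero C X Y) (f \<cdot> Zero C X Y) = f \<cdot> Plus C (Zero C X Y) (Zero C X Y)"
    using assms by (subst Comp_Plus_distrib) auto
  with assms show "Plus C (f \<cdot> Zero C X Y) (f \<cdot> Zero C X Y) =
      Plus C (f \<cdot> Zero C X Y) (Zero C X (Cod C f))" by auto
qed (use assms in auto)

lemma Comp_Zero_left [simp]:
  assumes "f \<in> Arr C" "Cod C f = Y" "Z \<in> Obj C"
  shows "Zero C Y Z \<cdot> f = Zero C (Dom C f) Z"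
proof (rule Plus_left_cancel[of "Zero C Y Z \<cdot> f"])
  have "Plus C (Zero C Y Z \<cdot> f) (Zero C Y Z \<cdot> f) = Plus C (Zero C Y Z) (Zero C Y Z) \<cdot> f"
    using assms by (subst Comp_Plus_distrib) auto
  with assms show "Plus C (Zero C Y Z \<cdot> f) (Zero C Y Z \<cdot> f) =
      Plus C (Zero C Y Z \<cdot> f) (Zero C (Dom C f) Z)" by auto
qed (use assms in auto)

end

section \<open>The opposite category\<close>

text \<open>Arrows, identities and addition stay the same and only directions are swapped, so the
  double opposite is equal to \<open>C\<close>, not just isomorphic to it. Notions then dualize by
  rewriting, and a dual theorem is the original one instantiated at \<open>op_cat C\<close>.\<close>

definition op_cat :: "('o, 'm) addcat \<Rightarrow> ('o, 'm) addcat" where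
  "op_cat C = C\<lparr>Dom := Cod C, Cod := Dom C, Comp := \<lambda>g f. f \<cdot>\<^bsub>C\<^esub> g, Zero := \<lambda>X Y. Zero C Y X\<rparr>"

lemma op_cat_simps [simp]:
  "Obj (op_cat C) = Obj C" "Arr (op_cat C) = Arr C" "Dom (op_cat C) = Cod C"
  "Cod (op_cat C) = Dom C" "Id (op_cat C) = Id C" "g \<cdot>\<^bsub>op_cat C\<^esub> f = f \<cdot>\<^bsub>C\<^esub> g"
  "Zero (op_cat C) X Y = Zero C Y X" "Plus (op_cat C) = Plus C"
  by (simp_all add: op_cat_def)

lemma op_op_cat [simp]: "op_cat (op_cat C) = C"
  by (simp add: op_cat_def)

lemma homset_op_cat [simp]: "homset (op_cat C) X Y = homset C Y X"
  by (auto simp: homset_def)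

lemma homgroup_op_cat [simp]: "homgroup (op_cat C) X Y = homgroup C Y X"
  by (simp add: homgroup_def)

lemma monic_op_cat [simp]: "monic (op_cat C) f \<longleftrightarrow> epic C f"
  by (simp add: monic_def epic_def)

lemma epic_op_cat [simp]: "epic (op_cat C) f \<longleftrightarrow> monic C f"
  by (simp add: monic_def epic_def)

lemma zero_object_op_cat [simp]: "zero_object (op_cat C) = zero_object C"
  by (auto simp: zero_object_def fun_eq_iff)

lemma iso_arrow_op_cat [simp]: "iso_arrow (op_cat C) = iso_arrow C"
  by (auto simp: iso_arrow_def fun_eq_iff)

lemma is_kernel_op_cat [simp]: "is_kernel (op_cat C) k f \<longleftrightarrow> is_cokernel C k f"
  unfolding is_kernel_def is_cokernel_def by (simp add: eq_commute)

lemma is_cokernel_op_cat [simp]: "is_cokernel (op_cat C) k f \<longleftrightarrow> is_kernel C k f"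
  unfolding is_kernel_def is_cokernel_def by (simp add: eq_commute)

lemma short_exact_op_cat [simp]: "short_exact (op_cat C) f g \<longleftrightarrow> short_exact C g f"
  by (auto simp: short_exact_def)

lemma is_biproduct_op_cat [simp]:
  "is_biproduct (op_cat C) X Y B i j p q \<longleftrightarrow> is_biproduct C X Y B p q i j"
  by (auto simp: is_biproduct_def)

lemma direct_sum_op_cat [simp]: "direct_sum (op_cat C) = direct_sum C"
  by (auto simp: direct_sum_def fun_eq_iff)

lemma direct_summand_op_cat [simp]: "direct_summand (op_cat C) = direct_summand C"
  by (simp add: direct_summand_def fun_eq_iff)

lemma projective_op_cat [simp]: "projective (op_cat C) = injective C"
  by (auto simp: projective_def injective_def fun_eq_iff)

lemma (in category) isomorphic_op_cat [simp]: "isomorphic (op_cat C) = isomorphic C"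
proof -
  have "isomorphic (op_cat C) X Y \<longleftrightarrow> isomorphic C Y X" for X Y
    by (simp add: isomorphic_def)
  then show ?thesis using isomorphic_sym by (auto simp: fun_eq_iff)
qed

lemma (in category) additive_subcat_op_cat [simp]:
  "additive_subcat (op_cat C) = additive_subcat C"
  by (simp add: additive_subcat_def full_subcat_def fun_eq_iff)

lemma (in category) category_op_cat: "category (op_cat C)"
  by (rule category.intro) (simp_all add: in_homset)

lemma (in preadditive_category) preadditive_category_op_cat: "preadditive_category (op_cat C)"
  by (intro preadditive_category.intro category_op_cat preadditive_category_axioms.intro)
    (simp_all add: in_homset homgroup)

lemma (in abelian_category) abelian_category_op_cat: "abelian_category (op_cat C)"
  by (intro abelian_category.intro preadditive_category_op_cat abelian_category_axioms.intro)
    (simp_all add: ex_zero_object ex_direct_sum ex_kernel ex_cokernel monic_normal epic_normal)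

section \<open>Kernels, biproducts and split sequences\<close>

context preadditive_category
begin

lemma monic_Arr: "monic C f \<Longrightarrow> f \<in> Arr C"
  by (simp add: monic_def)

lemma monicD:
  assumes "monic C f" "g \<in> Arr C" "h \<in> Arr C" "Cod C g = Dom C f" "Cod C h = Dom C f"
    "Dom C g = Dom C h" "f \<cdot> g = f \<cdot> h"
  shows "g = h"
proof -
  have "g \<in> homset C (Dom C h) (Dom C f)" "h \<in> homset C (Dom C h) (Dom C f)" "Dom C h \<in> Obj C"
    using assms by (simp_all add: in_homset)
  then show ?thesis using assms(1,7) unfolding monic_def by blast
qed

lemma monic_eq_ZeroD:
  assumes "monic C f" "g \<in> Arr C" "Dom C g = X" "Cod C g = Dom C f" "f \<cdot> g = Zero C X (Cod C f)"
  shows "g = Zero C X (Dom C f)"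
  by (rule monicD[OF assms(1)]) (use assms monic_Arr[OF assms(1)] in auto)

text \<open>Additivity reduces cancellation to zero composites: the difference of two arrows with
  equal composites is killed by \<open>f\<close>.\<close>

lemma monicI:
  assumes f: "f \<in> Arr C"
    and inj: "\<And>X g. g \<in> Arr C \<Longrightarrow> Dom C g = X \<Longrightarrow> Cod C g = Dom C f \<Longrightarrow> f \<cdot> g = Zero C X (Cod C f)
      \<Longrightarrow> g = Zero C X (Dom C f)"
  shows "monic C f"
  unfolding monic_def
proof (intro conjI ballI impI f)
  fix X g h
  assume X: "X \<in> Obj C" and "g \<in> homset C X (Dom C f)" "h \<in> homset C X (Dom C f)"
    and eq: "f \<cdot> g = f \<cdot> h"
  then have gh: "g \<in> Arr C" "h \<in> Arr C" "Dom C g = X" "Dom C h = X"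
    "Cod C g = Dom C f" "Cod C h = Dom C f"
    by (simp_all add: in_homset)
  obtain d where d: "d \<in> Arr C" "Dom C d = X" "Cod C d = Dom C f" "Plus C h d = g"
    using ex_difference[of g h] gh by auto
  have "Plus C (f \<cdot> h) (f \<cdot> d) = f \<cdot> Plus C h d" using f gh d by (subst Comp_Plus_distrib) auto
  also have "\<dots> = Plus C (f \<cdot> h) (Zero C X (Cod C f))" using d(4) eq f gh X by simp
  finally have "f \<cdot> d = Zero C X (Cod C f)"
    by (rule Plus_left_cancel[rotated 7]) (use f gh d X in simp_all)
  with d have "d = Zero C X (Dom C f)" by (intro inj)
  with d gh show "g = h" by auto
qed

lemma is_kernel_simps:
  assumes "is_kernel C k f"
  shows "k \<in> Arr C" "f \<in> Arr C" "Cod C k = Dom C f" "f \<cdot> k = Zero C (Dom C k) (Cod C f)"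
  using assms by (auto simp: is_kernel_def)

lemma kernel_factor:
  assumes "is_kernel C k f" "h \<in> Arr C" "Dom C h = X" "Cod C h = Dom C f"
    "f \<cdot> h = Zero C X (Cod C f)"
  obtains u where "u \<in> Arr C" "Dom C u = X" "Cod C u = Dom C k" "k \<cdot> u = h"
proof -
  have "\<exists>!u. u \<in> homset C (Dom C h) (Dom C k) \<and> k \<cdot> u = h"
    using assms unfolding is_kernel_def by blast
  then show thesis using that assms(3) by (auto simp: in_homset)
qed

text \<open>Both \<open>g\<close> and the zero arrow factor the zero arrow through \<open>k\<close>,
  so uniqueness of the factorization identifies them.\<close>

lemma kernel_monic:
  assumes "is_kernel C k f"
  shows "monic C k"
proof (rule monicI)
  note k = is_kernel_simps[OF assms]
  show "k \<in> Arr C" by (fact k)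
  fix X g
  assume g: "g \<in> Arr C" "Dom C g = X" "Cod C g = Dom C k" "k \<cdot> g = Zero C X (Cod C k)"
  then have X: "X \<in> Obj C" using Dom_closed by blast
  let ?z = "Zero C X (Cod C k)"
  have "?z \<in> Arr C \<and> Cod C ?z = Dom C f \<and> f \<cdot> ?z = Zero C (Dom C ?z) (Cod C f)" "Dom C ?z = X"
    using k X by simp_all
  then have "\<exists>!u. u \<in> homset C X (Dom C k) \<and> k \<cdot> u = ?z"
    using assms unfolding is_kernel_def by metis
  moreover have "g \<in> homset C X (Dom C k) \<and> k \<cdot> g = ?z" using g by (simp add: in_homset)
  moreover have "Zero C X (Dom C k) \<in> homset C X (Dom C k) \<and> k \<cdot> Zero C X (Dom C k) = ?z"
    using k X by (simp add: in_homset)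
  ultimately show "g = Zero C X (Dom C k)" by blast
qed

text \<open>A monic \<open>k\<close> makes factorizations unique, so existence is all that remains
  to be shown.\<close>

lemma is_kernelI:
  assumes "monic C k" "f \<in> Arr C" "Cod C k = Dom C f" "f \<cdot> k = Zero C (Dom C k) (Cod C f)"
    and "\<And>X h. h \<in> Arr C \<Longrightarrow> Dom C h = X \<Longrightarrow> Cod C h = Dom C f \<Longrightarrow> f \<cdot> h = Zero C X (Cod C f)
      \<Longrightarrow> \<exists>u. u \<in> Arr C \<and> Dom C u = X \<and> Cod C u = Dom C k \<and> k \<cdot> u = h"
  shows "is_kernel C k f"
  unfolding is_kernel_def
proof (intro conjI ballI impI)
  show "k \<in> Arr C" using assms(1) by (rule monic_Arr)
  fix h assume "h \<in> Arr C" and "Cod C h = Dom C f \<and> f \<cdot> h = Zero C (Dom C h) (Cod C f)"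
  then obtain u where u: "u \<in> Arr C \<and> Dom C u = Dom C h \<and> Cod C u = Dom C k \<and> k \<cdot> u = h"
    using assms(5)[of h "Dom C h"] by blast
  show "\<exists>!u. u \<in> homset C (Dom C h) (Dom C k) \<and> k \<cdot> u = h"
  proof (rule ex1I[of _ u])
    show "u \<in> homset C (Dom C h) (Dom C k) \<and> k \<cdot> u = h" using u by (simp add: in_homset)
    fix v assume "v \<in> homset C (Dom C h) (Dom C k) \<and> k \<cdot> v = h"
    with u have "v \<in> Arr C" "u \<in> Arr C" "Cod C v = Dom C k" "Cod C u = Dom C k"
      "Dom C v = Dom C u" "k \<cdot> v = k \<cdot> u" by (simp_all add: in_homset)
    then show "v = u" by (rule monicD[OF assms(1)])
  qed
qed (use assms in auto)

lemma epic_Arr: "epic C f \<Longrightarrow> f \<in> Arr C"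
  by (simp add: epic_def)

lemma epic_eq_ZeroD:
  assumes "epic C f" "g \<in> Arr C" "Cod C g = X" "Dom C g = Cod C f" "g \<cdot> f = Zero C (Dom C f) X"
  shows "g = Zero C (Cod C f) X"
  using preadditive_category.monic_eq_ZeroD[OF preadditive_category_op_cat, of f g X] assms
  by simp

lemma epicI:
  assumes "f \<in> Arr C"
    and "\<And>X g. g \<in> Arr C \<Longrightarrow> Cod C g = X \<Longrightarrow> Dom C g = Cod C f \<Longrightarrow> g \<cdot> f = Zero C (Dom C f) X
      \<Longrightarrow> g = Zero C (Cod C f) X"
  shows "epic C f"
  using preadditive_category.monicI[OF preadditive_category_op_cat, of f] assms by simp

lemma cokernel_factor:
  assumes "is_cokernel C p f" "h \<in> Arr C" "Cod C h = X" "Dom C h = Cod C f"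
    "h \<cdot> f = Zero C (Dom C f) X"
  obtains u where "u \<in> Arr C" "Cod C u = X" "Dom C u = Cod C p" "u \<cdot> p = h"
  using preadditive_category.kernel_factor[OF preadditive_category_op_cat, of p f h X] assms
  by auto

lemma cokernel_epic: "is_cokernel C p f \<Longrightarrow> epic C p"
  using preadditive_category.kernel_monic[OF preadditive_category_op_cat, of p f] by simp

lemma is_cokernel_simps:
  assumes "is_cokernel C p f"
  shows "p \<in> Arr C" "f \<in> Arr C" "Dom C p = Cod C f" "p \<cdot> f = Zero C (Dom C f) (Cod C p)"
  using assms by (auto simp: is_cokernel_def)

section \<open>Biproducts and split short exact sequences\<close>

lemma is_biproduct_simps:
  assumes "is_biproduct C X Y B i j p q"
  shows "X \<in> Obj C" "Y \<in> Obj C" "B \<in> Obj C"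
    "i \<in> Arr C" "Dom C i = X" "Cod C i = B" "j \<in> Arr C" "Dom C j = Y" "Cod C j = B"
    "p \<in> Arr C" "Dom C p = B" "Cod C p = X" "q \<in> Arr C" "Dom C q = B" "Cod C q = Y"
    "p \<cdot> i = Id C X" "q \<cdot> j = Id C Y" "p \<cdot> j = Zero C Y X" "q \<cdot> i = Zero C X Y"
    "Plus C (i \<cdot> p) (j \<cdot> q) = Id C B"
  using assms by (simp_all add: is_biproduct_def in_homset)

lemma biproduct_sym:
  assumes "is_biproduct C X Y B i j p q"
  shows "is_biproduct C Y X B j i q p"
  using is_biproduct_simps[OF assms]
  by (simp add: is_biproduct_def in_homset Plus_commute[of "j \<cdot> q"])

lemma direct_sum_sym: "direct_sum C X Y B \<Longrightarrow> direct_sum C Y X B"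
  unfolding direct_sum_def using biproduct_sym by blast

lemma biproduct_decompose:
  assumes "is_biproduct C X Y B i j p q" "h \<in> Arr C" "Cod C h = B"
  shows "Plus C (i \<cdot> (p \<cdot> h)) (j \<cdot> (q \<cdot> h)) = h"
proof -
  note b = is_biproduct_simps[OF assms(1)]
  have "Plus C (i \<cdot> (p \<cdot> h)) (j \<cdot> (q \<cdot> h)) = Plus C (i \<cdot> p) (j \<cdot> q) \<cdot> h"
    using b(1-15) assms(2,3) by simp
  also have "\<dots> = h" using b(20) assms(2,3) by simp
  finally show ?thesis .
qed

lemma biproduct_kernel:
  assumes "is_biproduct C X Y B i j p q"
  shows "is_kernel C i q"
proof -
  note b = is_biproduct_simps[OF assms]
  show ?thesis
  proof (rule is_kernelI)
    show "monic C i"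
    proof (rule monicI)
      fix W g assume g: "g \<in> Arr C" "Dom C g = W" "Cod C g = Dom C i" "i \<cdot> g = Zero C W (Cod C i)"
      have "g = p \<cdot> (i \<cdot> g)" using b(1-15) g(1-3) by (simp add: reassoc[OF b(16)])
      also have "\<dots> = Zero C W (Dom C i)" using b(1-15) g by auto
      finally show "g = Zero C W (Dom C i)" .
    qed (use b in simp)
    fix W h assume h: "h \<in> Arr C" "Dom C h = W" "Cod C h = Dom C q" "q \<cdot> h = Zero C W (Cod C q)"
    have "Plus C (i \<cdot> (p \<cdot> h)) (j \<cdot> (q \<cdot> h)) = h"
      by (rule biproduct_decompose[OF assms]) (use b h in auto)
    moreover have "j \<cdot> (q \<cdot> h) = Zero C W B" using h b by auto
    ultimately have "i \<cdot> (p \<cdot> h) = h" using b h by auto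
    then show "\<exists>u. u \<in> Arr C \<and> Dom C u = W \<and> Cod C u = Dom C i \<and> i \<cdot> u = h"
      by (intro exI[of _ "p \<cdot> h"]) (use b h in auto)
  qed (use b in auto)
qed

lemma biproduct_short_exact:
  assumes "is_biproduct C X Y B i j p q"
  shows "short_exact C i q"
proof -
  \<comment> \<open>In the opposite category \<open>q\<close> and \<open>i\<close> become an
    injection and the complementary projection, with the two summands swapped.\<close>
  have "is_kernel (op_cat C) q i"
    by (rule preadditive_category.biproduct_kernel[OF preadditive_category_op_cat,
          of Y X B q p j i]) (use biproduct_sym[OF assms] in simp)
  then show ?thesis using biproduct_kernel[OF assms] by (simp add: short_exact_def)
qed

lemma direct_sum_short_exact:
  assumes "direct_sum C X Y B"
  obtains f g where "short_exact C f g" "Dom C f = X" "Cod C f = B" "Cod C g = Y"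
  using assms biproduct_short_exact is_biproduct_simps unfolding direct_sum_def by metis

lemma short_exact_simps:
  assumes "short_exact C f g"
  shows "f \<in> Arr C" "g \<in> Arr C" "Cod C f = Dom C g" "g \<cdot> f = Zero C (Dom C f) (Cod C g)"
    "monic C f" "epic C g"
  using assms is_kernel_simps kernel_monic cokernel_epic unfolding short_exact_def by auto

text \<open>The arrow \<open>d = id - s \<cdot> g\<close> is killed by \<open>g\<close>, hence
  factors through the kernel as \<open>f \<cdot> r\<close>. This \<open>r\<close> is the missing
  projection: its equations follow by cancelling the monic \<open>f\<close>.\<close>

lemma split_epi_biproduct:
  assumes "short_exact C f g" "s \<in> Arr C" "Dom C s = Cod C g" "Cod C s = Dom C g"
    "g \<cdot> s = Id C (Cod C g)"
  obtains r where "is_biproduct C (Dom C f) (Cod C g) (Cod C f) f s r g"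
proof -
  define X Y B where "X = Dom C f" and "Y = Cod C g" and "B = Cod C f"
  have f: "f \<in> Arr C" "Dom C f = X" "Cod C f = B" and g: "g \<in> Arr C" "Dom C g = B" "Cod C g = Y"
    and s: "s \<in> Arr C" "Dom C s = Y" "Cod C s = B"
    and gf: "g \<cdot> f = Zero C X Y" and gs: "g \<cdot> s = Id C Y" and mono: "monic C f"
    using short_exact_simps[OF assms(1)] assms by (simp_all add: X_def Y_def B_def)
  have obj: "X \<in> Obj C" "Y \<in> Obj C" "B \<in> Obj C" using f g by (metis Dom_closed Cod_closed)+
  obtain d where d: "d \<in> Arr C" "Dom C d = B" "Cod C d = B" "Plus C (s \<cdot> g) d = Id C B"
    using ex_difference[of "Id C B" "s \<cdot> g"] obj s g by auto
  have "Plus C g (g \<cdot> d) = g \<cdot> Plus C (s \<cdot> g) d"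
    using d(1-3) g s obj by (simp add: reassoc[OF gs])
  also have "\<dots> = Plus C g (Zero C B Y)" using d g obj by simp
  finally have "g \<cdot> d = Zero C B Y"
    by (rule Plus_left_cancel[rotated 7]) (use g d obj in simp_all)
  then obtain r where r: "r \<in> Arr C" "Dom C r = B" "Cod C r = X" "f \<cdot> r = d"
    using kernel_factor[of f g d B] assms(1) d f g unfolding short_exact_def by auto
  have "Plus C (f \<cdot> r) (s \<cdot> g) = Id C B"
    using r d g s Plus_commute[of d "s \<cdot> g"] by simp
  have "f \<cdot> (r \<cdot> f) = d \<cdot> f" by (rule reassoc[OF r(4)]) (use r f in simp_all)
  also have "\<dots> = Plus C (s \<cdot> g) d \<cdot> f" using d(1-3) f g s obj by (simp add: gf)
  also have "\<dots> = f \<cdot> Id C X" using d f by simp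
  finally have "r \<cdot> f = Id C X" by (rule monicD[OF mono, rotated -1]) (use r f obj in simp_all)
  have "Plus C s (f \<cdot> (r \<cdot> s)) = Plus C s (d \<cdot> s)"
    by (subst reassoc[OF r(4)]) (use r f s in simp_all)
  also have "\<dots> = Plus C (s \<cdot> g) d \<cdot> s" using d(1-3) f g s obj by (simp add: gs)
  also have "\<dots> = Plus C s (Zero C Y B)" using d s obj by simp
  finally have "f \<cdot> (r \<cdot> s) = Zero C Y B"
    by (rule Plus_left_cancel[rotated 7]) (use f r s d obj in simp_all)
  then have "r \<cdot> s = Zero C Y X"
    using monic_eq_ZeroD[OF mono, of "r \<cdot> s" Y] r s f by simp
  have "is_biproduct C X Y B f s r g"
    unfolding is_biproduct_def in_homset by (intro conjI; (fact | rule obj | simp add: gf))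
  then show thesis using that by (simp add: X_def Y_def B_def)
qed

section \<open>Zero objects and complements\<close>

lemma zero_object_Obj: "zero_object C Z \<Longrightarrow> Z \<in> Obj C"
  by (simp add: zero_object_def)

lemma zero_object_arrow_from:
  assumes "zero_object C Z" "f \<in> Arr C" "Dom C f = Z" "Cod C f = Y"
  shows "f = Zero C Z Y"
proof -
  have "Y \<in> Obj C" "Z \<in> Obj C" using assms Cod_closed zero_object_Obj by blast+
  then have "\<exists>!f. f \<in> homset C Z Y" "f \<in> homset C Z Y" "Zero C Z Y \<in> homset C Z Y"
    using assms by (simp_all add: zero_object_def in_homset)
  then show ?thesis by blast
qed

lemma zero_object_arrow_to:
  assumes "zero_object C Z" "f \<in> Arr C" "Cod C f = Z" "Dom C f = Y"
  shows "f = Zero C Y Z"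
  using preadditive_category.zero_object_arrow_from[OF preadditive_category_op_cat, of Z f Y] assms
  by simp

lemma zero_objectI:
  assumes "Z \<in> Obj C" "Id C Z = Zero C Z Z"
  shows "zero_object C Z"
proof -
  have to: "f = Zero C X Z" if f: "f \<in> Arr C" "Dom C f = X" "Cod C f = Z" for f X
  proof -
    have "f = Id C Z \<cdot> f" using f by simp
    also have "\<dots> = Zero C X Z" using f by (simp add: assms)
    finally show ?thesis .
  qed
  have "from": "f = Zero C Z X" if f: "f \<in> Arr C" "Dom C f = Z" "Cod C f = X" for f X
  proof -
    have "f = f \<cdot> Id C Z" using f by simp
    also have "\<dots> = Zero C Z X" using f assms by (simp add: assms)
    finally show ?thesis .
  qed
  show ?thesis
    unfolding zero_object_def
  proof (intro conjI ballI assms(1))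
    fix X assume X: "X \<in> Obj C"
    show "\<exists>!f. f \<in> homset C X Z"
      using X assms(1) to by (intro ex1I[of _ "Zero C X Z"]) (simp_all add: in_homset)
    show "\<exists>!f. f \<in> homset C Z X"
      using X assms(1) "from" by (intro ex1I[of _ "Zero C Z X"]) (simp_all add: in_homset)
  qed
qed

text \<open>With a zero complement, closure under isomorphism becomes a case of closure under
  summands, and isomorphic objects are joined by a split exact sequence.\<close>

lemma isomorphic_direct_summand:
  assumes "isomorphic C X Y" "zero_object C Z"
  shows "direct_sum C Y Z X"
proof -
  have obj: "X \<in> Obj C" "Y \<in> Obj C" "Z \<in> Obj C"
    using assms isomorphic_Obj zero_object_Obj by blast+
  obtain u where u: "Dom C u = X" "Cod C u = Y" "iso_arrow C u"
    using assms by (auto simp: isomorphic_def in_homset)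
  obtain v where v: "u \<in> Arr C" "v \<in> Arr C" "Dom C v = Cod C u" "Cod C v = Dom C u"
    "v \<cdot> u = Id C (Dom C u)" "u \<cdot> v = Id C (Cod C u)" by (rule iso_arrowE[OF u(3)])
  have "Zero C Z Z = Id C Z" using zero_object_arrow_from[OF assms(2), of "Id C Z" Z] obj by simp
  then have "is_biproduct C Y Z X v (Zero C Z X) u (Zero C X Z)"
    using u v obj by (simp add: is_biproduct_def in_homset)
  then show ?thesis unfolding direct_sum_def by blast
qed

text \<open>Strictness holds because \<open>i \<cdot> h \<cdot> p\<close> embeds the endomorphisms of \<open>K\<close> into those of \<open>M\<close>
  but misses the identity.\<close>

lemma card_End_summand_less:
  assumes "is_biproduct C K P M i j p q" "\<not> zero_object C P" "finite (homset C M M)"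
  shows "card (homset C K K) < card (homset C M M)"
proof -
  note b = is_biproduct_simps[OF assms(1)]
  let ?e = "\<lambda>h. i \<cdot> (h \<cdot> p)"
  have inj: "inj_on ?e (homset C K K)"
  proof (rule inj_on_inverseI[where g = "\<lambda>h. p \<cdot> (h \<cdot> i)"])
    fix h assume "h \<in> homset C K K"
    then have h: "h \<in> Arr C" "Dom C h = K" "Cod C h = K" by (simp_all add: in_homset)
    show "p \<cdot> (i \<cdot> (h \<cdot> p) \<cdot> i) = h"
      using h b(1-15) by (simp add: b(16) reassoc[OF b(16)])
  qed
  have sub: "?e ` homset C K K \<subseteq> homset C M M" using b by (auto simp: in_homset)
  have "Id C M \<notin> ?e ` homset C K K"
  proof
    assume "Id C M \<in> ?e ` homset C K K"
    then obtain h where h: "h \<in> Arr C" "Dom C h = K" "Cod C h = K" "Id C M = i \<cdot> (h \<cdot> p)"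
      by (auto simp: in_homset)
    \<comment> \<open>An endomorphism that factors through \<open>K\<close> vanishes when restricted
      along \<open>j\<close> and projected by \<open>q\<close>, whereas the identity of
      \<open>M\<close> becomes that of \<open>P\<close>.\<close>
    have "Id C P = q \<cdot> (Id C M \<cdot> j)" using b by simp
    also have "\<dots> = Zero C P P"
      using h(1-3) b(1-15) by (simp add: h(4) b(18) reassoc[OF b(19)])
    finally show False using zero_objectI b(2) assms(2) by blast
  qed
  moreover have "Id C M \<in> homset C M M" using b by (simp add: in_homset)
  ultimately have "?e ` homset C K K \<subset> homset C M M" using sub by blast
  then have "card (?e ` homset C K K) < card (homset C M M)"
    using assms(3) by (rule psubset_card_mono[rotated])
  then show ?thesis by (simp add: card_image[OF inj])
qed

end

section \<open>Hom-orthogonality\<close>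

definition hom_vanishes :: "('o, 'm) addcat \<Rightarrow> 'o \<Rightarrow> 'o \<Rightarrow> bool" where
  "hom_vanishes C X Y \<longleftrightarrow> (\<forall>f\<in>homset C X Y. f = Zero C X Y)"

text \<open>The two orthogonals are additive and closed under extensions and summands, so
  \<open>Add_subcat_least\<close> and \<open>ext_generated_least\<close> apply to them:
  orthogonality checked on generators spreads to everything generated.\<close>

definition left_orth :: "('o, 'm) addcat \<Rightarrow> 'o set \<Rightarrow> 'o set" where
  "left_orth C T = {X \<in> Obj C. \<forall>Y\<in>T. hom_vanishes C X Y}"

definition right_orth :: "('o, 'm) addcat \<Rightarrow> 'o set \<Rightarrow> 'o set" where
  "right_orth C T = {Y \<in> Obj C. \<forall>X\<in>T. hom_vanishes C X Y}"

lemma hom_vanishesD: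
  "hom_vanishes C X Y \<Longrightarrow> f \<in> Arr C \<Longrightarrow> Dom C f = X \<Longrightarrow> Cod C f = Y \<Longrightarrow> f = Zero C X Y"
  by (simp add: hom_vanishes_def in_homset)

lemma left_orth_op_cat [simp]: "left_orth (op_cat C) T = right_orth C T"
  by (simp add: left_orth_def right_orth_def hom_vanishes_def)

lemma right_orth_op_cat [simp]: "right_orth (op_cat C) T = left_orth C T"
  by (simp add: left_orth_def right_orth_def hom_vanishes_def)

lemma ext_closed_op_cat [simp]: "ext_closed (op_cat C) P \<longleftrightarrow> ext_closed C P"
proof -
  \<comment> \<open>The middle term of the sequence is read as \<open>Cod C f\<close> in one
    category and as \<open>Dom C g\<close> in its opposite.\<close>
  have "Cod C f = Dom C g" if "short_exact C f g" for f g
    using that by (simp add: short_exact_def is_kernel_def)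
  then show ?thesis unfolding ext_closed_def by fastforce
qed

lemma ext_closedD:
  "ext_closed C P \<Longrightarrow> short_exact C f g \<Longrightarrow> Dom C f \<in> P \<Longrightarrow> Cod C g \<in> P \<Longrightarrow> Cod C f \<in> P"
  by (auto simp: ext_closed_def)

lemma additive_subcat_simps:
  assumes "additive_subcat C P"
  shows "P \<subseteq> Obj C" "full_subcat C P" "zero_object C Z \<Longrightarrow> Z \<in> P"
    "X \<in> P \<Longrightarrow> Y \<in> P \<Longrightarrow> direct_sum C X Y B \<Longrightarrow> B \<in> P"
  using assms unfolding additive_subcat_def full_subcat_def by blast+

context preadditive_category
begin

lemma left_orth_quotient:
  assumes "epic C g" "Dom C g \<in> left_orth C T"
  shows "Cod C g \<in> left_orth C T"
  unfolding left_orth_def hom_vanishes_def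
proof (intro CollectI conjI ballI)
  have g: "g \<in> Arr C" using assms(1) by (rule epic_Arr)
  then show "Cod C g \<in> Obj C" by simp
  fix Y h assume Y: "Y \<in> T" and "h \<in> homset C (Cod C g) Y"
  then have h: "h \<in> Arr C" "Dom C h = Cod C g" "Cod C h = Y" by (simp_all add: in_homset)
  have "hom_vanishes C (Dom C g) Y" using assms(2) Y by (simp add: left_orth_def)
  then have "h \<cdot> g = Zero C (Dom C g) Y" using g h by (intro hom_vanishesD) simp_all
  then show "h = Zero C (Cod C g) Y" using epic_eq_ZeroD[OF assms(1), of h Y] h by simp
qed

lemma right_orth_subobject:
  assumes "monic C f" "Cod C f \<in> right_orth C T"
  shows "Dom C f \<in> right_orth C T"
  using preadditive_category.left_orth_quotient[OF preadditive_category_op_cat, of f T] assms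
  by simp

text \<open>An arrow out of the middle term vanishes on the subobject, hence factors through the
  quotient, where it vanishes again.\<close>

lemma ext_closed_left_orth: "ext_closed C (left_orth C T)"
  unfolding ext_closed_def
proof (intro allI impI, elim conjE)
  fix f g assume se: "short_exact C f g" and D: "Dom C f \<in> left_orth C T" "Cod C g \<in> left_orth C T"
  note fg = short_exact_simps[OF se]
  show "Cod C f \<in> left_orth C T"
    unfolding left_orth_def hom_vanishes_def
  proof (intro CollectI conjI ballI)
    show "Cod C f \<in> Obj C" using fg by simp
    fix Y h assume Y: "Y \<in> T" and "h \<in> homset C (Cod C f) Y"
    then have h: "h \<in> Arr C" "Dom C h = Cod C f" "Cod C h = Y" by (simp_all add: in_homset)
    have van: "hom_vanishes C (Dom C f) Y" "hom_vanishes C (Cod C g) Y"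
      using D Y by (simp_all add: left_orth_def)
    have "h \<cdot> f = Zero C (Dom C f) Y" using van(1) fg h by (intro hom_vanishesD) simp_all
    then obtain v where v: "v \<in> Arr C" "Cod C v = Y" "Dom C v = Cod C g" "v \<cdot> g = h"
      using cokernel_factor[of g f h Y] se h unfolding short_exact_def by auto
    have "v = Zero C (Cod C g) Y" using van(2) v by (intro hom_vanishesD) simp_all
    moreover have "Y \<in> Obj C" using h by auto
    ultimately show "h = Zero C (Cod C f) Y" using v fg by auto
  qed
qed

lemma zero_object_left_orth: "zero_object C Z \<Longrightarrow> Z \<in> left_orth C T"
  by (auto simp: left_orth_def hom_vanishes_def in_homset zero_object_Obj intro: zero_object_arrow_from)

lemma left_orth_isomorphic:
  assumes "X \<in> left_orth C T" "isomorphic C X Y"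
  shows "Y \<in> left_orth C T"
proof -
  obtain u where u: "Dom C u = X" "Cod C u = Y" "iso_arrow C u"
    using assms by (auto simp: isomorphic_def in_homset)
  obtain v where v: "u \<in> Arr C" "v \<in> Arr C" "Dom C v = Cod C u" "Cod C v = Dom C u"
    "v \<cdot> u = Id C (Dom C u)" "u \<cdot> v = Id C (Cod C u)" by (rule iso_arrowE[OF u(3)])
  have "epic C u"
  proof (rule epicI)
    fix W g assume g: "g \<in> Arr C" "Cod C g = W" "Dom C g = Cod C u" "g \<cdot> u = Zero C (Dom C u) W"
    have "g = g \<cdot> (u \<cdot> v)" using g u v by simp
    also have "\<dots> = Zero C (Dom C u) W \<cdot> v" by (rule reassoc) (use g v in simp_all)
    also have "\<dots> = Zero C (Cod C u) W" using g v by auto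
    finally show "g = Zero C (Cod C u) W" .
  qed (fact v)
  then show ?thesis using left_orth_quotient[of u T] assms(1) u by simp
qed

lemma additive_subcat_left_orth: "additive_subcat C (left_orth C T)"
  unfolding additive_subcat_def full_subcat_def
proof (intro conjI ballI allI impI)
  fix X Y B assume "X \<in> left_orth C T" "Y \<in> left_orth C T" "direct_sum C X Y B"
  then show "B \<in> left_orth C T"
    using ext_closedD[OF ext_closed_left_orth] by (elim direct_sum_short_exact) auto
next
  show "left_orth C T \<subseteq> Obj C" by (auto simp: left_orth_def)
qed (blast intro: left_orth_isomorphic zero_object_left_orth)+

lemma left_orth_summand:
  assumes "direct_summand C X M" "M \<in> left_orth C T"
  shows "X \<in> left_orth C T"
proof -
  \<comment> \<open>Listing the complement first makes \<open>X\<close> the quotient in the split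
    sequence.\<close>
  obtain Y where "direct_sum C Y X M"
    using assms(1) direct_sum_sym unfolding direct_summand_def by blast
  then show ?thesis
    using assms(2) left_orth_quotient short_exact_simps by (elim direct_sum_short_exact) metis
qed

lemma ext_closed_right_orth: "ext_closed C (right_orth C T)"
  using preadditive_category.ext_closed_left_orth[OF preadditive_category_op_cat, of T] by simp

lemma additive_subcat_right_orth: "additive_subcat C (right_orth C T)"
  using preadditive_category.additive_subcat_left_orth[OF preadditive_category_op_cat, of T] by simp

lemma right_orth_summand: "direct_summand C X M \<Longrightarrow> M \<in> right_orth C T \<Longrightarrow> X \<in> right_orth C T"
  using preadditive_category.left_orth_summand[OF preadditive_category_op_cat, of X M T] by simp

section \<open>Closure properties of projective objects\<close>

lemma projectiveE:
  assumes "projective C P" "epic C e" "f \<in> Arr C" "Dom C f = P" "Cod C f = Cod C e"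
  obtains g where "g \<in> Arr C" "Dom C g = P" "Cod C g = Dom C e" "e \<cdot> g = f"
proof -
  have "f \<in> homset C P (Cod C e)" using assms by (simp add: in_homset)
  then obtain g where "g \<in> homset C P (Dom C e)" "e \<cdot> g = f"
    using assms(1,2) unfolding projective_def by blast
  then show thesis using that by (auto simp: in_homset)
qed

lemma projectiveI:
  assumes "P \<in> Obj C"
    and "\<And>e f. epic C e \<Longrightarrow> f \<in> Arr C \<Longrightarrow> Dom C f = P \<Longrightarrow> Cod C f = Cod C e
      \<Longrightarrow> \<exists>g. g \<in> Arr C \<and> Dom C g = P \<and> Cod C g = Dom C e \<and> e \<cdot> g = f"
  shows "projective C P"
  using assms by (simp add: projective_def Bex_def in_homset)

text \<open>Lift \<open>f \<cdot> p\<close> from \<open>M\<close> and restrict the lift along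
  \<open>i\<close>.\<close>

lemma projective_summand:
  assumes "direct_summand C X M" "projective C M"
  shows "projective C X"
proof -
  obtain Y i j p q where bi: "is_biproduct C X Y M i j p q"
    using assms(1) unfolding direct_summand_def direct_sum_def by blast
  note b = is_biproduct_simps[OF bi]
  show ?thesis
  proof (rule projectiveI)
    fix e f assume e: "epic C e" and f: "f \<in> Arr C" "Dom C f = X" "Cod C f = Cod C e"
    obtain g where g: "g \<in> Arr C" "Dom C g = M" "Cod C g = Dom C e" "e \<cdot> g = f \<cdot> p"
      by (rule projectiveE[OF assms(2) e, of "f \<cdot> p"]) (use f b in simp_all)
    have "e \<cdot> (g \<cdot> i) = f \<cdot> p \<cdot> i" by (rule reassoc[OF g(4)]) (use g f b epic_Arr[OF e] in simp_all)
    also have "\<dots> = f" using f b by simp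
    finally show "\<exists>g. g \<in> Arr C \<and> Dom C g = X \<and> Cod C g = Dom C e \<and> e \<cdot> g = f"
      using g b by (intro exI[of _ "g \<cdot> i"]) simp
  qed (fact b)
qed

lemma projective_direct_sum:
  assumes "direct_sum C X Y B" "projective C X" "projective C Y"
  shows "projective C B"
proof -
  obtain i j p q where bi: "is_biproduct C X Y B i j p q"
    using assms(1) unfolding direct_sum_def by blast
  note b = is_biproduct_simps[OF bi]
  show ?thesis
  proof (rule projectiveI)
    fix e f assume e: "epic C e" and f: "f \<in> Arr C" "Dom C f = B" "Cod C f = Cod C e"
    have e': "e \<in> Arr C" using e by (rule epic_Arr)
    obtain g where g: "g \<in> Arr C" "Dom C g = X" "Cod C g = Dom C e" "e \<cdot> g = f \<cdot> i"
      by (rule projectiveE[OF assms(2) e, of "f \<cdot> i"]) (use f b in simp_all)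
    obtain h where h: "h \<in> Arr C" "Dom C h = Y" "Cod C h = Dom C e" "e \<cdot> h = f \<cdot> j"
      by (rule projectiveE[OF assms(3) e, of "f \<cdot> j"]) (use f b in simp_all)
    have "e \<cdot> Plus C (g \<cdot> p) (h \<cdot> q) = Plus C (e \<cdot> (g \<cdot> p)) (e \<cdot> (h \<cdot> q))"
      using e' g(1-3) h(1-3) b(1-15) by simp
    also have "e \<cdot> (g \<cdot> p) = f \<cdot> (i \<cdot> p)"
      using reassoc[OF g(4), of p] e' g(1-3) f b(1-15) by simp
    also have "e \<cdot> (h \<cdot> q) = f \<cdot> (j \<cdot> q)"
      using reassoc[OF h(4), of q] e' h(1-3) f b(1-15) by simp
    also have "Plus C (f \<cdot> (i \<cdot> p)) (f \<cdot> (j \<cdot> q)) = f \<cdot> Plus C (i \<cdot> p) (j \<cdot> q)"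
      using f b(1-15) by simp
    also have "\<dots> = f" using f b(20) by simp
    finally show "\<exists>g. g \<in> Arr C \<and> Dom C g = B \<and> Cod C g = Dom C e \<and> e \<cdot> g = f"
      using g h b by (intro exI[of _ "Plus C (g \<cdot> p) (h \<cdot> q)"]) simp
  qed (fact b)
qed

lemma projective_zero_object:
  assumes "zero_object C Z"
  shows "projective C Z"
proof (rule projectiveI)
  show Z: "Z \<in> Obj C" using assms by (rule zero_object_Obj)
  fix e f assume e: "epic C e" and f: "f \<in> Arr C" "Dom C f = Z" "Cod C f = Cod C e"
  then have "f = Zero C Z (Cod C e)" using assms zero_object_arrow_from by blast
  then show "\<exists>g. g \<in> Arr C \<and> Dom C g = Z \<and> Cod C g = Dom C e \<and> e \<cdot> g = f"
    using epic_Arr[OF e] Z by (intro exI[of _ "Zero C Z (Dom C e)"]) simp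
qed

end

section \<open>Simple, projective and injective objects\<close>

context abelian_category
begin

lemma projective_isomorphic: "projective C X \<Longrightarrow> isomorphic C X Y \<Longrightarrow> projective C Y"
  using ex_zero_object isomorphic_direct_summand projective_summand
  unfolding direct_summand_def by blast

lemma additive_subcat_projective: "additive_subcat C {X. projective C X}"
proof -
  have "{X. projective C X} \<subseteq> Obj C" by (auto simp: projective_def)
  then show ?thesis
    unfolding additive_subcat_def full_subcat_def mem_Collect_eq
    by (blast intro: projective_zero_object projective_direct_sum projective_isomorphic)
qed

lemma short_exact_split:
  assumes "short_exact C k f" "projective C (Cod C f)"
  obtains s r where "is_biproduct C (Dom C k) (Cod C f) (Cod C k) k s r f"
proof -
  note kf = short_exact_simps[OF assms(1)]
  obtain s where s: "s \<in> Arr C" "Dom C s = Cod C f" "Cod C s = Dom C f" "f \<cdot> s = Id C (Cod C f)"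
    by (rule projectiveE[OF assms(2) kf(6), of "Id C (Cod C f)"]) (use kf in simp_all)
  show thesis using split_epi_biproduct[OF assms(1) s] that by blast
qed

text \<open>A projective quotient splits the sequence, so closure under direct sums
  suffices.\<close>

lemma ext_closed_projective:
  assumes "additive_subcat C P" "\<And>X. X \<in> P \<Longrightarrow> projective C X"
  shows "ext_closed C P"
  unfolding ext_closed_def
proof (intro allI impI, elim conjE)
  fix f g assume se: "short_exact C f g" and P: "Dom C f \<in> P" "Cod C g \<in> P"
  obtain s r where "is_biproduct C (Dom C f) (Cod C g) (Cod C f) f s r g"
    by (rule short_exact_split[OF se assms(2)[OF P(2)]])
  then show "Cod C f \<in> P"
    using P additive_subcat_simps(4)[OF assms(1)] unfolding direct_sum_def by blast
qed

lemma additive_subcat_injective: "additive_subcat C {X. injective C X}"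
  using abelian_category.additive_subcat_projective[OF abelian_category_op_cat] by simp

lemma injective_summand: "direct_summand C X M \<Longrightarrow> injective C M \<Longrightarrow> injective C X"
  using preadditive_category.projective_summand[OF preadditive_category_op_cat, of X M] by simp

lemma injective_isomorphic: "injective C X \<Longrightarrow> isomorphic C X Y \<Longrightarrow> injective C Y"
  using abelian_category.projective_isomorphic[OF abelian_category_op_cat, of X Y] by simp

lemma ext_closed_injective:
  "additive_subcat C P \<Longrightarrow> (\<And>X. X \<in> P \<Longrightarrow> injective C X) \<Longrightarrow> ext_closed C P"
  using abelian_category.ext_closed_projective[OF abelian_category_op_cat, of P] by simp

text \<open>By normality \<open>k\<close> is the kernel of some \<open>f\<close>, and
  \<open>f\<close> factors through the cokernel \<open>p\<close>. So whatever \<open>p\<close> kills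
  is killed by \<open>f\<close> and factors through \<open>k\<close>.\<close>

lemma monic_cokernel_short_exact:
  assumes k: "monic C k" and p: "is_cokernel C p k"
  shows "short_exact C k p"
proof -
  obtain f where f: "is_kernel C k f" using monic_normal k by blast
  note kf = is_kernel_simps[OF f] and pk = is_cokernel_simps[OF p]
  obtain f' where f': "f' \<in> Arr C" "Dom C f' = Cod C p" "Cod C f' = Cod C f" "f' \<cdot> p = f"
    using cokernel_factor[OF p, of f "Cod C f"] kf by auto
  have "is_kernel C k p"
  proof (rule is_kernelI[OF k])
    fix X h assume h: "h \<in> Arr C" "Dom C h = X" "Cod C h = Dom C p" "p \<cdot> h = Zero C X (Cod C p)"
    have "f \<cdot> h = f' \<cdot> (p \<cdot> h)" by (rule reassoc[OF f'(4), symmetric]) (use h f' pk in simp_all)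
    also have "\<dots> = Zero C X (Cod C f)" using h f' by auto
    finally show "\<exists>u. u \<in> Arr C \<and> Dom C u = X \<and> Cod C u = Dom C k \<and> k \<cdot> u = h"
      using kernel_factor[OF f, of h X] h kf pk by metis
  qed (use pk in auto)
  with p show ?thesis by (simp add: short_exact_def)
qed

lemma epic_kernel_short_exact:
  assumes "epic C p" "is_kernel C k p"
  shows "short_exact C k p"
  using abelian_category.monic_cokernel_short_exact[OF abelian_category_op_cat, of p k] assms
  by simp

text \<open>A monic \<open>k\<close> is the kernel of some \<open>f\<close>, and \<open>f\<close> is
  zero because \<open>k\<close> is epic. Hence the identity factors through \<open>k\<close>, and
  this right inverse is two-sided because \<open>k\<close> is monic.\<close>

lemma monic_epic_iso:
  assumes "monic C k" "epic C k"
  shows "iso_arrow C k"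
proof -
  obtain f where f: "is_kernel C k f" using monic_normal assms by blast
  note kf = is_kernel_simps[OF f]
  have "f = Zero C (Cod C k) (Cod C f)" by (rule epic_eq_ZeroD[OF assms(2)]) (use kf in auto)
  then have "f \<cdot> Id C (Cod C k) = Zero C (Cod C k) (Cod C f)" using kf by simp
  then obtain u where u: "u \<in> Arr C" "Dom C u = Cod C k" "Cod C u = Dom C k" "k \<cdot> u = Id C (Cod C k)"
    using kernel_factor[OF f, of "Id C (Cod C k)" "Cod C k"] kf by auto
  have "u \<cdot> k = Id C (Dom C k)"
  proof (rule monicD[OF assms(1)])
    show "k \<cdot> (u \<cdot> k) = k \<cdot> Id C (Dom C k)" using u kf reassoc[OF u(4), of k] by simp
  qed (use u kf in simp_all)
  then show ?thesis using u kf by (intro iso_arrowI[of k u]) auto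
qed

text \<open>The kernel of \<open>f\<close> is a subobject of a simple object: if it is zero,
  \<open>f\<close> is monic; if it is everything, \<open>f\<close> is zero.\<close>

lemma simple_monic:
  assumes "simple C X" "f \<in> Arr C" "Dom C f = X" "f \<noteq> Zero C X (Cod C f)"
  shows "monic C f"
proof -
  obtain k where k: "is_kernel C k f" using ex_kernel assms by blast
  note kf = is_kernel_simps[OF k]
  have "zero_object C (Dom C k) \<or> iso_arrow C k"
    using assms(1) kernel_monic[OF k] kf(3) assms(3) unfolding simple_def by simp
  then show ?thesis
  proof
    assume z: "zero_object C (Dom C k)"
    show ?thesis
    proof (rule monicI)
      fix W g assume g: "g \<in> Arr C" "Dom C g = W" "Cod C g = Dom C f" "f \<cdot> g = Zero C W (Cod C f)"
      obtain u where u: "u \<in> Arr C" "Dom C u = W" "Cod C u = Dom C k" "k \<cdot> u = g"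
        by (rule kernel_factor[OF k g])
      have "u = Zero C W (Dom C k)" by (rule zero_object_arrow_to[OF z]) (use u in simp_all)
      moreover have "W \<in> Obj C" using g by auto
      ultimately show "g = Zero C W (Dom C f)" using u kf by auto
    qed (fact assms)
  next
    assume "iso_arrow C k"
    then obtain v where v: "v \<in> Arr C" "Dom C v = Cod C k" "Cod C v = Dom C k"
      "k \<cdot> v = Id C (Cod C k)" by (rule iso_arrowE)
    have "f = f \<cdot> (k \<cdot> v)" using v kf by simp
    also have "\<dots> = Zero C (Dom C k) (Cod C f) \<cdot> v" by (rule reassoc[OF kf(4)]) (use v kf in simp_all)
    also have "\<dots> = Zero C X (Cod C f)" using v kf assms(3) by simp
    finally show ?thesis using assms(4) by blast
  qed
qed

text \<open>\<open>simple\<close> speaks of subobjects only. An epic arrow out of \<open>X\<close>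
  is either nonzero, hence monic and invertible, or zero, and then the identity of its codomain is
  zero.\<close>

lemma simple_op_cat:
  assumes "simple C X"
  shows "simple (op_cat C) X"
proof -
  have "zero_object C (Cod C e) \<or> iso_arrow C e" if e: "epic C e" "Dom C e = X" for e
  proof (cases "e = Zero C X (Cod C e)")
    case False
    then have "monic C e" using simple_monic[OF assms] e epic_Arr by blast
    then show ?thesis using monic_epic_iso e by blast
  next
    case True
    have e': "e \<in> Arr C" "Dom C e = X" "X \<in> Obj C" using e epic_Arr Dom_closed by blast+
    then have "Id C (Cod C e) \<cdot> e = Zero C (Dom C e) (Cod C e)" using True by simp
    then have "Id C (Cod C e) = Zero C (Cod C e) (Cod C e)"
      by (intro epic_eq_ZeroD[OF e(1)]) (use e' in simp_all)
    then show ?thesis using zero_objectI e' by simp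
  qed
  then show ?thesis using assms by (simp add: simple_def)
qed

lemma simple_op_cat_iff: "simple (op_cat C) X \<longleftrightarrow> simple C X"
  using simple_op_cat abelian_category.simple_op_cat[OF abelian_category_op_cat, of X] by auto

lemma simple_epic:
  assumes "simple C Y" "f \<in> Arr C" "Cod C f = Y" "f \<noteq> Zero C (Dom C f) Y"
  shows "epic C f"
  using abelian_category.simple_monic[OF abelian_category_op_cat simple_op_cat, of Y f] assms
  by simp

lemma Schur:
  assumes "simple C X" "simple C Y" "\<not> isomorphic C X Y"
  shows "hom_vanishes C X Y"
proof (rule ccontr)
  assume "\<not> hom_vanishes C X Y"
  then obtain f where f: "f \<in> Arr C" "Dom C f = X" "Cod C f = Y" "f \<noteq> Zero C X Y"
    by (auto simp: hom_vanishes_def in_homset)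
  then have "monic C f" "epic C f"
    using simple_monic[OF assms(1)] simple_epic[OF assms(2)] by simp_all
  then have "iso_arrow C f" by (rule monic_epic_iso)
  then show False using assms(3) f by (auto simp: isomorphic_def in_homset)
qed

text \<open>With \<open>0 \<rightarrow> U \<rightarrow> M \<rightarrow> S \<rightarrow> 0\<close> and \<open>0 \<rightarrow> A \<rightarrow> U \<rightarrow> B \<rightarrow> 0\<close> exact, the extension \<open>M / A\<close> of
  \<open>S\<close> by \<open>B\<close> splits as soon as \<open>U \<rightarrow> B\<close> extends to \<open>M\<close>.\<close>

lemma short_exact_quotient_sum:
  assumes se: "short_exact C u p" "short_exact C f g" "Cod C f = Dom C u"
    and g': "g' \<in> Arr C" "Dom C g' = Cod C u" "Cod C g' = Cod C g" "g' \<cdot> u = g"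
    and ds: "direct_sum C (Cod C g) (Cod C p) B"
  shows "\<exists>m. short_exact C (u \<cdot> f) m \<and> Cod C m = B"
proof -
  obtain i j a b where bi: "is_biproduct C (Cod C g) (Cod C p) B i j a b"
    using ds unfolding direct_sum_def by blast
  note b = is_biproduct_simps[OF bi]
  define A U M Q S where "A = Dom C f" and "U = Dom C u" and "M = Cod C u" and "Q = Cod C g"
    and "S = Cod C p"
  note up = short_exact_simps[OF se(1)] and fg = short_exact_simps[OF se(2)]
  have f: "f \<in> Arr C" "Dom C f = A" "Cod C f = U" and g: "g \<in> Arr C" "Dom C g = U" "Cod C g = Q"
    and u: "u \<in> Arr C" "Dom C u = U" "Cod C u = M" and p: "p \<in> Arr C" "Dom C p = M" "Cod C p = S"
    and h: "g' \<in> Arr C" "Dom C g' = M" "Cod C g' = Q"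
    and pu: "p \<cdot> u = Zero C U S" and gf: "g \<cdot> f = Zero C A Q"
    using up fg se g' by (simp_all add: A_def U_def M_def Q_def S_def)
  have i: "i \<in> Arr C" "Dom C i = Q" "Cod C i = B" and j: "j \<in> Arr C" "Dom C j = S" "Cod C j = B"
    and a: "a \<in> Arr C" "Dom C a = B" "Cod C a = Q" and b': "b \<in> Arr C" "Dom C b = B" "Cod C b = S"
    and ai: "a \<cdot> i = Id C Q" and bj: "b \<cdot> j = Id C S" and aj: "a \<cdot> j = Zero C S Q"
    and bi0: "b \<cdot> i = Zero C Q S" and sum: "Plus C (i \<cdot> a) (j \<cdot> b) = Id C B"
    using b by (simp_all add: Q_def S_def)
  have obj: "A \<in> Obj C" "U \<in> Obj C" "M \<in> Obj C" "Q \<in> Obj C" "S \<in> Obj C" "B \<in> Obj C"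
    using f u g p b(3) by (metis Dom_closed Cod_closed)+
  \<comment> \<open>This is the arrow from \<open>M\<close> to \<open>Q \<oplus> S\<close> with
    components \<open>g'\<close> and \<open>p\<close>.\<close>
  define m where "m = Plus C (i \<cdot> g') (j \<cdot> p)"
  have m: "m \<in> Arr C" "Dom C m = M" "Cod C m = B" using i h j p by (simp_all add: m_def)
  have am: "a \<cdot> m = g'" using i h j p a obj
    by (simp add: m_def reassoc[OF ai] reassoc[OF aj])
  have bm: "b \<cdot> m = p" using i h j p b' obj
    by (simp add: m_def reassoc[OF bj] reassoc[OF bi0])
  have epi: "epic C m"
  proof (rule epicI)
    fix X t assume t: "t \<in> Arr C" "Cod C t = X" "Dom C t = Cod C m" "t \<cdot> m = Zero C (Dom C m) X"
    have X: "X \<in> Obj C" using t by auto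
    have tm: "Plus C (t \<cdot> (i \<cdot> g')) (t \<cdot> (j \<cdot> p)) = Zero C M X"
      using t m i h j p by (simp add: m_def)
    \<comment> \<open>Restriction along \<open>u\<close> isolates the component of \<open>t\<close>
      on \<open>Q\<close>, because \<open>p \<cdot> u\<close> vanishes and
      \<open>g' \<cdot> u\<close> is the epic \<open>g\<close>. The component on \<open>S\<close>
      then vanishes because \<open>p\<close> is epic.\<close>
    have "t \<cdot> i \<cdot> g = t \<cdot> (i \<cdot> (g' \<cdot> u))" using t m i g by (simp add: g'(4))
    also have "\<dots> = Plus C (t \<cdot> (i \<cdot> g')) (t \<cdot> (j \<cdot> p)) \<cdot> u"
      using t(1-3) m i h j p u X obj by (simp add: pu)
    also have "\<dots> = Zero C U X" using tm u X obj by simp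
    finally have ti: "t \<cdot> i = Zero C Q X"
      using epic_eq_ZeroD[OF fg(6), of "t \<cdot> i" X] t m i g by simp
    have "t \<cdot> (i \<cdot> g') = Zero C Q X \<cdot> g'" by (rule reassoc[OF ti]) (use t m i h in simp_all)
    then have "t \<cdot> j \<cdot> p = Zero C M X" using tm t m i h j p X obj by simp
    then have tj: "t \<cdot> j = Zero C S X"
      using epic_eq_ZeroD[OF up(6), of "t \<cdot> j" X] t m j p by simp
    have "t = t \<cdot> Plus C (i \<cdot> a) (j \<cdot> b)" using sum t m by simp
    also have "\<dots> = Zero C B X"
      using t(1-3) m i j a b' X obj by (simp add: reassoc[OF ti] reassoc[OF tj])
    finally show "t = Zero C (Cod C m) X" using m by simp
  qed (fact m)
  have "is_kernel C (u \<cdot> f) m"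
  proof (rule is_kernelI)
    show "monic C (u \<cdot> f)"
    proof (rule monicI)
      fix W t assume t: "t \<in> Arr C" "Dom C t = W" "Cod C t = Dom C (u \<cdot> f)"
        "u \<cdot> f \<cdot> t = Zero C W (Cod C (u \<cdot> f))"
      then have "u \<cdot> (f \<cdot> t) = Zero C W (Cod C u)" using f u by simp
      then have "f \<cdot> t = Zero C W (Cod C f)"
        using monic_eq_ZeroD[OF up(5), of "f \<cdot> t" W] t f u by simp
      then show "t = Zero C W (Dom C (u \<cdot> f))"
        using monic_eq_ZeroD[OF fg(5), of t W] t f u by simp
    qed (use f u in simp)
    show "m \<cdot> (u \<cdot> f) = Zero C (Dom C (u \<cdot> f)) (Cod C m)"
    proof -
      have "g' \<cdot> (u \<cdot> f) = Zero C A Q" "p \<cdot> (u \<cdot> f) = Zero C A S"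
        using f u h p obj gf by (simp_all add: reassoc[OF g'(4)] reassoc[OF pu])
      then show ?thesis using m f u i j p h obj by (simp add: m_def)
    qed
    fix W t assume t: "t \<in> Arr C" "Dom C t = W" "Cod C t = Dom C m" "m \<cdot> t = Zero C W (Cod C m)"
    have W: "W \<in> Obj C" using t by auto
    \<comment> \<open>If \<open>m\<close> kills \<open>t\<close>, the component \<open>p\<close>
      puts \<open>t\<close> into \<open>U\<close>, and the component \<open>g'\<close>, which
      restricts to \<open>g\<close> on \<open>U\<close>, puts it into \<open>A\<close>.\<close>
    have "p \<cdot> t = b \<cdot> (m \<cdot> t)" by (rule reassoc[OF bm, symmetric]) (use t m b' in simp_all)
    then have pt: "p \<cdot> t = Zero C W (Cod C p)" using t(4) m b' p W by simp
    have "g' \<cdot> t = a \<cdot> (m \<cdot> t)" by (rule reassoc[OF am, symmetric]) (use t m a in simp_all)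
    then have gt: "g' \<cdot> t = Zero C W Q" using t(4) m a W by simp
    obtain k where k: "k \<in> Arr C" "Dom C k = W" "Cod C k = U" "u \<cdot> k = t"
      using kernel_factor[of u p t W] se(1) t(1-3) m p u pt unfolding short_exact_def by auto
    have "g \<cdot> k = g' \<cdot> (u \<cdot> k)" by (rule reassoc[OF g'(4), symmetric]) (use k u h in simp_all)
    then have "g \<cdot> k = Zero C W (Cod C g)" using gt k(4) g by simp
    then obtain l where l: "l \<in> Arr C" "Dom C l = W" "Cod C l = A" "f \<cdot> l = k"
      using kernel_factor[of f g k W] se(2) k g f unfolding short_exact_def by auto
    then show "\<exists>l. l \<in> Arr C \<and> Dom C l = W \<and> Cod C l = Dom C (u \<cdot> f) \<and> u \<cdot> f \<cdot> l = t"
      using u f k by (intro exI[of _ l]) simp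
  qed (use m f u in simp_all)
  with epi m show ?thesis using epic_kernel_short_exact by blast
qed

text \<open>The kernel of \<open>g \<cdot> r\<close> is the preimage under \<open>r\<close> of the
  subobject \<open>f\<close>. It is an extension of \<open>Dom C f\<close> by
  \<open>Dom C s\<close>, which the lift \<open>f'\<close> of \<open>f\<close> splits.\<close>

lemma short_exact_sub_sum:
  assumes "short_exact C s r" "short_exact C f g" "Dom C g = Cod C r"
    and "f' \<in> Arr C" "Cod C f' = Dom C r" "Dom C f' = Dom C f" "r \<cdot> f' = f"
    and "direct_sum C (Dom C f) (Dom C s) B"
  shows "\<exists>m. short_exact C m (g \<cdot> r) \<and> Dom C m = B"
  using abelian_category.short_exact_quotient_sum[OF abelian_category_op_cat, of r s g f f' B] assms
  by simp

end

section \<open>Generated subcategories and factorizing pairs\<close>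

context preadditive_category
begin

lemma direct_summand_Obj: "direct_summand C X M \<Longrightarrow> X \<in> Obj C"
  by (auto simp: direct_summand_def direct_sum_def is_biproduct_def)

lemma additive_subcat_Obj: "additive_subcat C (Obj C)"
  by (auto simp: additive_subcat_def full_subcat_def direct_sum_def is_biproduct_def
      zero_object_Obj)

lemma ext_closed_Obj: "ext_closed C (Obj C)"
  using short_exact_simps(1) Cod_closed unfolding ext_closed_def by blast

text \<open>An empty family would have the whole type as its intersection; the families behind
  \<open>Add_subcat\<close> and \<open>ext_generated\<close> contain \<open>Obj C\<close>.\<close>

lemma additive_subcat_Inter:
  assumes "\<And>P. P \<in> F \<Longrightarrow> additive_subcat C P" "F \<noteq> {}"
  shows "additive_subcat C (\<Inter>F)"
  unfolding additive_subcat_def full_subcat_def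
proof (intro conjI ballI allI impI InterI)
  note P = additive_subcat_simps[OF assms(1)]
  show "\<Inter>F \<subseteq> Obj C" using P(1) assms(2) by blast
  fix P assume P': "P \<in> F"
  show "Y \<in> P" if "X \<in> \<Inter>F" "Y \<in> Obj C" "isomorphic C X Y" for X Y
    using P(2)[OF P'] that P' unfolding full_subcat_def by blast
  show "Z \<in> P" if "zero_object C Z" for Z using P(3)[OF P'] that by blast
  show "B \<in> P" if "X \<in> \<Inter>F" "Y \<in> \<Inter>F" "direct_sum C X Y B" for X Y B
    using P(4)[OF P' _ _ that(3)] that P' by blast
qed

lemma additive_subcat_Add_subcat: "additive_subcat C (Add_subcat C S)"
  unfolding Add_subcat_def
proof (rule additive_subcat_Inter)
  have "Obj C \<in> {P. additive_subcat C P \<and>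
     (\<forall>M\<in>Obj C. iso_class C M \<in> S \<longrightarrow> (\<forall>N. direct_summand C N M \<longrightarrow> N \<in> P))}"
    using additive_subcat_Obj direct_summand_Obj by blast
  then show "{P. additive_subcat C P \<and>
     (\<forall>M\<in>Obj C. iso_class C M \<in> S \<longrightarrow> (\<forall>N. direct_summand C N M \<longrightarrow> N \<in> P))} \<noteq> {}"
    by blast
qed blast

text \<open>An \<open>M\<close> whose class is a generator is only isomorphic to some
  \<open>X\<close> with \<open>R X\<close>, so closure of \<open>P\<close> under isomorphism acts
  first and closure under summands second.\<close>

lemma Add_subcat_least:
  assumes "additive_subcat C P" and "\<And>X M. direct_summand C X M \<Longrightarrow> M \<in> P \<Longrightarrow> X \<in> P"
    and "\<And>X. R X \<Longrightarrow> X \<in> P"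
  shows "Add_subcat C {iso_class C X | X. R X} \<subseteq> P"
proof -
  have "N \<in> P" if "M \<in> Obj C" "iso_class C M = iso_class C X" "R X" "direct_summand C N M"
    for M N X
  proof -
    have "isomorphic C X M" using iso_class_eqD[of X M] that by simp
    then have "M \<in> P"
      using assms(1) that(1) assms(3)[OF that(3)]
      unfolding additive_subcat_def full_subcat_def by blast
    then show ?thesis using assms(2) that(4) by blast
  qed
  then show ?thesis using assms(1) unfolding Add_subcat_def by blast
qed

lemma ext_generated_least:
  "additive_subcat C P \<Longrightarrow> ext_closed C P \<Longrightarrow> A \<subseteq> P \<Longrightarrow> B \<subseteq> P \<Longrightarrow> ext_generated C A B \<subseteq> P"
  unfolding ext_generated_def by blast

lemma ext_generated_upper: "A \<subseteq> ext_generated C A B" "B \<subseteq> ext_generated C A B"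
  unfolding ext_generated_def by blast+

lemma ext_closed_ext_generated: "ext_closed C (ext_generated C A B)"
  unfolding ext_closed_def ext_generated_def by blast

lemma additive_subcat_ext_generated:
  assumes "A \<subseteq> Obj C" "B \<subseteq> Obj C"
  shows "additive_subcat C (ext_generated C A B)"
  unfolding ext_generated_def
proof (rule additive_subcat_Inter)
  have "Obj C \<in> {P. additive_subcat C P \<and> ext_closed C P \<and> A \<subseteq> P \<and> B \<subseteq> P}"
    using additive_subcat_Obj ext_closed_Obj assms by blast
  then show "{P. additive_subcat C P \<and> ext_closed C P \<and> A \<subseteq> P \<and> B \<subseteq> P} \<noteq> {}" by blast
qed blast

end

context abelian_category
begin

lemma mem_Add_subcat:
  assumes "X \<in> Obj C" "iso_class C X \<in> S"
  shows "X \<in> Add_subcat C S"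
proof -
  have "direct_summand C X X"
    using isomorphic_direct_summand[OF isomorphic_refl] assms(1) ex_zero_object
    unfolding direct_summand_def by blast
  then show ?thesis using assms unfolding Add_subcat_def by blast
qed

lemma injectiveE:
  assumes "injective C I" "monic C m" "f \<in> Arr C" "Cod C f = I" "Dom C f = Dom C m"
  obtains g where "g \<in> Arr C" "Cod C g = I" "Dom C g = Cod C m" "g \<cdot> m = f"
  using preadditive_category.projectiveE[OF preadditive_category_op_cat, of I m f] assms by auto

text \<open>Two subobjects with this property factor through one another.\<close>

lemma ex1_torsion_subobject:
  assumes orth: "\<And>X Y. X \<in> T \<Longrightarrow> Y \<in> F \<Longrightarrow> hom_vanishes C X Y"
    and ex: "short_exact C i p" "Cod C i = M" "Dom C i \<in> T" "Cod C p \<in> F"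
  shows "\<exists>!U. U \<in> subobjects C M \<and>
    (\<exists>i\<in>U. Dom C i \<in> T \<and> (\<exists>p. is_cokernel C p i \<and> Cod C p \<in> F))"
proof -
  \<comment> \<open>By orthogonality the composite of \<open>b\<close> with the quotient arrow of
    \<open>a\<close> is zero, so \<open>b\<close> factors through the kernel
    \<open>a\<close>.\<close>
  have factor: "\<exists>u. u \<in> Arr C \<and> Dom C u = Dom C b \<and> Cod C u = Dom C a \<and> a \<cdot> u = b"
    if a: "monic C a" "is_cokernel C p a" "Cod C p \<in> F" and b: "monic C b" "Dom C b \<in> T"
      and ab: "Cod C a = Cod C b" for a b p
  proof -
    have se: "short_exact C a p" using a monic_cokernel_short_exact by blast
    note ap = short_exact_simps[OF se]
    have b': "b \<in> Arr C" using b(1) by (rule monic_Arr)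
    have bp: "Cod C b = Dom C p" using ab ap(3) by simp
    have "p \<cdot> b = Zero C (Dom C b) (Cod C p)"
      by (rule hom_vanishesD[OF orth]) (use a b b' bp ap in simp_all)
    then show ?thesis
      using kernel_factor[of a p b "Dom C b"] se b' bp unfolding short_exact_def by metis
  qed
  have rel: "(a, b) \<in> sub_equiv C M"
    if a: "a \<in> monos_into C M" "is_cokernel C p a" "Cod C p \<in> F" "Dom C a \<in> T"
      and b: "b \<in> monos_into C M" "is_cokernel C q b" "Cod C q \<in> F" "Dom C b \<in> T" for a b p q
  proof -
    have mono: "monic C a" "monic C b" "Cod C a = M" "Cod C b = M"
      using a b by (simp_all add: monos_into_def)
    obtain u where u: "u \<in> Arr C" "Dom C u = Dom C a" "Cod C u = Dom C b" "b \<cdot> u = a"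
      using factor[OF mono(2) b(2,3) mono(1) a(4)] mono by auto
    obtain v where v: "v \<in> Arr C" "Dom C v = Dom C b" "Cod C v = Dom C a" "a \<cdot> v = b"
      using factor[OF mono(1) a(2,3) mono(2) b(4)] mono by auto
    have arr: "a \<in> Arr C" "b \<in> Arr C" using mono monic_Arr by blast+
    have "a \<cdot> (v \<cdot> u) = b \<cdot> u" by (rule reassoc[OF v(4)]) (use u v arr in simp_all)
    then have "a \<cdot> (v \<cdot> u) = a \<cdot> Id C (Dom C a)" using u(4) arr by simp
    then have vu: "v \<cdot> u = Id C (Dom C a)"
      by (rule monicD[OF mono(1), rotated -1]) (use u v arr in simp_all)
    have "b \<cdot> (u \<cdot> v) = a \<cdot> v" by (rule reassoc[OF u(4)]) (use u v arr in simp_all)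
    then have "b \<cdot> (u \<cdot> v) = b \<cdot> Id C (Dom C b)" using v(4) arr by simp
    then have uv: "u \<cdot> v = Id C (Dom C b)"
      by (rule monicD[OF mono(2), rotated -1]) (use u v arr in simp_all)
    have "iso_arrow C u" by (rule iso_arrowI[of u v]) (use u v uv vu in simp_all)
    moreover have "u \<in> homset C (Dom C a) (Dom C b)" using u by (simp add: in_homset)
    ultimately show ?thesis using a(1) b(1) u(4) unfolding sub_equiv_def by blast
  qed
  note eq = equiv_sub_equiv[of M]
  have i: "i \<in> monos_into C M" "is_cokernel C p i"
    using ex short_exact_simps[OF ex(1)] by (simp_all add: monos_into_def short_exact_def)
  show ?thesis
  proof (rule ex1I[of _ "sub_equiv C M `` {i}"], intro conjI)
    show "sub_equiv C M `` {i} \<in> subobjects C M"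
      unfolding subobjects_def using i(1) by (rule quotientI)
    have "i \<in> sub_equiv C M `` {i}" using eq i(1) by (rule equiv_class_self)
    then show "\<exists>i\<in>sub_equiv C M `` {i}. Dom C i \<in> T \<and> (\<exists>p. is_cokernel C p i \<and> Cod C p \<in> F)"
      using i(2) ex(3,4) by blast
    fix U assume U: "U \<in> subobjects C M \<and>
      (\<exists>i\<in>U. Dom C i \<in> T \<and> (\<exists>p. is_cokernel C p i \<and> Cod C p \<in> F))"
    \<comment> \<open>The arrow \<open>j\<close> in \<open>U\<close> that has the property may
      differ from the representative \<open>k\<close> of \<open>U\<close>, so \<open>i\<close> is
      compared with \<open>j\<close>.\<close>
    then obtain j q where j: "j \<in> U" "Dom C j \<in> T" "is_cokernel C q j" "Cod C q \<in> F" by blast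
    from U obtain k where k: "k \<in> monos_into C M" "U = sub_equiv C M `` {k}"
      unfolding subobjects_def by (auto elim: quotientE)
    have kj: "(k, j) \<in> sub_equiv C M" using j(1) k(2) by simp
    then have "j \<in> monos_into C M" by (simp add: sub_equiv_def)
    then have "(i, j) \<in> sub_equiv C M" using rel i ex j by blast
    then show "U = sub_equiv C M `` {i}"
      using kj k(2) equiv_class_eq[OF eq] by metis
  qed
qed

text \<open>\<open>T\<close> and \<open>F\<close> act as torsion and torsion-free class:
  orthogonality settles uniqueness, and one exact sequence per object remains to be found.\<close>

lemma factorizing_pairI:
  assumes "additive_subcat C B" "ext_closed C B" "additive_subcat C F" "ext_closed C F" "F \<subseteq> B"
    and "additive_subcat C T" "ext_closed C T" "T \<subseteq> B"
    and orth: "\<And>X Y. X \<in> T \<Longrightarrow> Y \<in> F \<Longrightarrow> hom_vanishes C X Y"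
    and ex: "\<And>M. M \<in> B \<Longrightarrow>
      \<exists>i p. short_exact C i p \<and> Cod C i = M \<and> Dom C i \<in> T \<and> Cod C p \<in> F"
  shows "factorizing_pair C B F T"
  unfolding factorizing_pair_def
proof (intro conjI ballI)
  fix M assume "M \<in> B"
  then obtain i p where "short_exact C i p" "Cod C i = M" "Dom C i \<in> T" "Cod C p \<in> F"
    using ex by blast
  then show "\<exists>!U. U \<in> subobjects C M \<and>
      (\<exists>i\<in>U. Dom C i \<in> T \<and> (\<exists>p. is_cokernel C p i \<and> Cod C p \<in> F))"
    by (intro ex1_torsion_subobject orth)
qed (use assms additive_subcat_simps(2) in blast)+

text \<open>A nonzero arrow into a simple object is epic, and projectivity of its codomain splits
  it. The biproduct data are kept because the induction in \<open>left_orth_decomposition\<close>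
  continues with the complement \<open>Dom C k\<close>.\<close>

lemma simple_projective_quotient_split:
  assumes "simple C P" "projective C P" "M \<in> Obj C" "\<not> hom_vanishes C M P"
  obtains k s r h where "is_biproduct C (Dom C k) P M k s r h"
proof -
  obtain h where h: "h \<in> Arr C" "Dom C h = M" "Cod C h = P" "h \<noteq> Zero C M P"
    using assms(4) by (auto simp: hom_vanishes_def in_homset)
  then have epi: "epic C h" using simple_epic assms(1) by simp
  obtain k where "is_kernel C k h" using ex_kernel h by blast
  then have se: "short_exact C k h" using epi epic_kernel_short_exact by blast
  have "Cod C k = M" using short_exact_simps[OF se] h by simp
  then show thesis using short_exact_split[OF se] assms(2) h that by metis
qed

lemma simple_injective_sub_summand:
  assumes "simple C P" "injective C P" "M \<in> Obj C" "\<not> hom_vanishes C P M"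
  shows "direct_summand C P M"
proof -
  have "\<not> hom_vanishes (op_cat C) M P" using assms(4) by (simp add: hom_vanishes_def)
  obtain k s r h where
    "is_biproduct (op_cat C) (Dom (op_cat C) k) P M k s r h"
    by (rule abelian_category.simple_projective_quotient_split
        [OF abelian_category_op_cat simple_op_cat[OF assms(1)], of M])
      (use assms \<open>\<not> hom_vanishes (op_cat C) M P\<close> in simp_all)
  then have "is_biproduct C (Cod C k) P M r h k s" by simp
  then show ?thesis using biproduct_sym unfolding direct_summand_def direct_sum_def by blast
qed

text \<open>While some \<open>P\<close> in \<open>T\<close> receives a nonzero arrow,
  \<open>M\<close> is \<open>K \<oplus> P\<close>. The subobject found in \<open>K\<close> serves
  for \<open>M\<close> unchanged and its quotient grows by the summand \<open>P\<close>, so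
  \<open>Q\<close> has to be closed under direct sums only.\<close>

lemma left_orth_decomposition:
  assumes Q: "additive_subcat C Q" and T: "\<And>P. P \<in> T \<Longrightarrow> simple C P \<and> projective C P \<and> P \<in> Q"
    and fin: "\<And>X. X \<in> Obj C \<Longrightarrow> finite (homset C X X)" and M: "M \<in> Obj C"
  shows "\<exists>f g. short_exact C f g \<and> Cod C f = M \<and> Dom C f \<in> left_orth C T \<and> Cod C g \<in> Q"
  using M
proof (induction M rule: measure_induct_rule[where f = "\<lambda>M. card (homset C M M)"])
  case (less M)
  show ?case
  proof (cases "M \<in> left_orth C T")
    case True
    obtain Z where Z: "zero_object C Z" using ex_zero_object by blast
    then have "direct_sum C M Z M"
      using isomorphic_direct_summand isomorphic_refl less.prems by blast
    then obtain f g where "short_exact C f g" "Dom C f = M" "Cod C f = M" "Cod C g = Z"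
      by (rule direct_sum_short_exact)
    then show ?thesis using True additive_subcat_simps(3)[OF Q Z] by blast
  next
    case False
    then obtain P where P: "P \<in> T" "\<not> hom_vanishes C M P"
      using less.prems by (auto simp: left_orth_def)
    obtain k s r h where bi: "is_biproduct C (Dom C k) P M k s r h"
      using simple_projective_quotient_split T[OF P(1)] less.prems P(2) by blast
    note b = is_biproduct_simps[OF bi]
    have "card (homset C (Dom C k) (Dom C k)) < card (homset C M M)"
      using card_End_summand_less[OF bi] T[OF P(1)] fin less.prems by (simp add: simple_def)
    then obtain f g where se: "short_exact C f g" and f: "Cod C f = Dom C k"
      "Dom C f \<in> left_orth C T" and g: "Cod C g \<in> Q"
      using less.IH b(1) by blast
    note fg = short_exact_simps[OF se]
    obtain B where B: "direct_sum C (Cod C g) (Cod C h) B"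
      using ex_direct_sum[OF Cod_closed Cod_closed] fg(2) b(13) by blast
    \<comment> \<open>The arrow \<open>g\<close> on the summand \<open>Dom C k\<close> extends to
      \<open>M\<close> through the projection \<open>r\<close>.\<close>
    have "\<exists>m. short_exact C (k \<cdot> f) m \<and> Cod C m = B"
      using short_exact_quotient_sum[OF biproduct_short_exact[OF bi] se f(1), of "g \<cdot> r" B] fg f b B
      by simp
    then obtain m where m: "short_exact C (k \<cdot> f) m" "Cod C m = B" by blast
    have "Cod C m \<in> Q"
      using additive_subcat_simps(4)[OF Q g _ B] T[OF P(1)] b m(2) by simp
    moreover have "Cod C (k \<cdot> f) = M" "Dom C (k \<cdot> f) = Dom C f" using fg f b by simp_all
    ultimately show ?thesis using m(1) f(2) by metis
  qed
qed

lemma right_orth_decomposition: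
  assumes "additive_subcat C Q" "\<And>P. P \<in> T \<Longrightarrow> simple C P \<and> injective C P \<and> P \<in> Q"
    and "\<And>X. X \<in> Obj C \<Longrightarrow> finite (homset C X X)" "M \<in> Obj C"
  shows "\<exists>f g. short_exact C f g \<and> Cod C f = M \<and> Dom C f \<in> Q \<and> Cod C g \<in> right_orth C T"
proof -
  have "\<exists>f g. short_exact C g f \<and> Dom C f = M \<and> Cod C f \<in> right_orth C T \<and> Dom C g \<in> Q"
    using abelian_category.left_orth_decomposition[OF abelian_category_op_cat, of Q T M] assms
    by (simp add: simple_op_cat_iff)
  then show ?thesis using short_exact_simps(3) by metis
qed

text \<open>The top member \<open>Dom C (i n)\<close> of the series is only isomorphic to
  \<open>M\<close>. Allowing a zero quotient in \<open>step\<close> covers this last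
  passage.\<close>

lemma composition_series_induct:
  assumes cs: "composition_series C M n i"
    and zero: "\<And>Z. zero_object C Z \<Longrightarrow> P Z"
    and step: "\<And>u p. short_exact C u p \<Longrightarrow> P (Dom C u) \<Longrightarrow>
      simple C (Cod C p) \<or> zero_object C (Cod C p) \<Longrightarrow> P (Cod C u)"
  shows "P M"
proof -
  have mono: "monic C (i k)" "Cod C (i k) = M" if "k \<le> n" for k
    using cs that by (simp_all add: composition_series_def monos_into_def)
  have "P (Dom C (i k))" if "k \<le> n" for k
    using that
  proof (induction k)
    case 0
    then show ?case using cs zero by (simp add: composition_series_def)
  next
    case (Suc k)
    from cs Suc.prems obtain u p where uh: "u \<in> homset C (Dom C (i k)) (Dom C (i (Suc k)))"
      and iu: "i (Suc k) \<cdot> u = i k" and p: "is_cokernel C p u" "simple C (Cod C p)"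
      unfolding composition_series_def Suc_le_eq by blast
    have u: "u \<in> Arr C" "Dom C u = Dom C (i k)" "Cod C u = Dom C (i (Suc k))"
      "i (Suc k) \<cdot> u = i k"
      using uh iu by (simp_all add: in_homset)
    have m: "monic C (i k)" "monic C (i (Suc k))" "Cod C (i k) = M" "Cod C (i (Suc k)) = M"
      using mono Suc.prems by simp_all
    have "monic C u"
    proof (rule monicI)
      fix W g assume g: "g \<in> Arr C" "Dom C g = W" "Cod C g = Dom C u" "u \<cdot> g = Zero C W (Cod C u)"
      have W: "W \<in> Obj C" using g by auto
      have "i k \<cdot> g = i (Suc k) \<cdot> (u \<cdot> g)"
        by (rule reassoc[OF u(4), symmetric]) (use u g m monic_Arr in simp_all)
      also have "\<dots> = Zero C W (Cod C (i k))"
        using g(4) u m W monic_Arr by simp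
      finally have "g = Zero C W (Dom C (i k))"
        by (rule monic_eq_ZeroD[OF m(1), rotated -1]) (use g u in simp_all)
      then show "g = Zero C W (Dom C u)" using u by simp
    qed (fact u)
    then have "short_exact C u p" using p monic_cokernel_short_exact by blast
    then show ?case using step[of u p] Suc u p by simp
  qed
  then have Pn: "P (Dom C (i n))" by simp
  \<comment> \<open>The isomorphism is recast as a short exact sequence with zero quotient, to which
    \<open>step\<close> applies.\<close>
  obtain Z where Z: "zero_object C Z" using ex_zero_object by blast
  have "isomorphic C (Dom C (i n)) M"
    using cs mono[of n] monic_Arr by (auto simp: composition_series_def isomorphic_def in_homset
        intro!: bexI[of _ "i n"])
  then have "direct_sum C (Dom C (i n)) Z M"
    using isomorphic_direct_summand isomorphic_sym Z by blast
  then obtain f g where "short_exact C f g" "Dom C f = Dom C (i n)" "Cod C f = M" "Cod C g = Z"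
    by (rule direct_sum_short_exact)
  then show ?thesis using step Pn Z by metis
qed

text \<open>Injectivity is asked of every object of \<open>R\<close>, because the arrow to be
  extended lands in the whole quotient collected so far; projectivity is asked of the simple top
  factor alone.\<close>

lemma projective_injective_filtration:
  assumes Q: "additive_subcat C Q" and R: "additive_subcat C R" "\<And>X. X \<in> R \<Longrightarrow> injective C X"
    and simple: "\<And>S. simple C S \<Longrightarrow> projective C S \<and> S \<in> Q \<or> S \<in> R"
    and cs: "composition_series C M n i"
  shows "\<exists>f g. short_exact C f g \<and> Cod C f = M \<and> Dom C f \<in> Q \<and> Cod C g \<in> R"
  using cs
proof (rule composition_series_induct)
  fix Z assume Z: "zero_object C Z"
  then have "direct_sum C Z Z Z"
    using isomorphic_direct_summand isomorphic_refl zero_object_Obj by blast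
  then obtain f g where "short_exact C f g" "Dom C f = Z" "Cod C f = Z" "Cod C g = Z"
    by (rule direct_sum_short_exact)
  then show "\<exists>f g. short_exact C f g \<and> Cod C f = Z \<and> Dom C f \<in> Q \<and> Cod C g \<in> R"
    using additive_subcat_simps(3)[OF Q Z] additive_subcat_simps(3)[OF R(1) Z] by metis
next
  fix u p
  assume up: "short_exact C u p"
    and "\<exists>f g. short_exact C f g \<and> Cod C f = Dom C u \<and> Dom C f \<in> Q \<and> Cod C g \<in> R"
    and S: "simple C (Cod C p) \<or> zero_object C (Cod C p)"
  then obtain f g where fg: "short_exact C f g" "Cod C f = Dom C u" "Dom C f \<in> Q" "Cod C g \<in> R"
    by blast
  note u = short_exact_simps[OF up] and f = short_exact_simps[OF fg(1)]
  \<comment> \<open>A zero top factor is counted as an object of \<open>R\<close>.\<close>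
  have "projective C (Cod C p) \<and> Cod C p \<in> Q \<or> Cod C p \<in> R"
    using S simple additive_subcat_simps(3)[OF R(1)] by blast
  then show "\<exists>f g. short_exact C f g \<and> Cod C f = Cod C u \<and> Dom C f \<in> Q \<and> Cod C g \<in> R"
  proof
    assume inj: "Cod C p \<in> R"
    obtain g' where g': "g' \<in> Arr C" "Cod C g' = Cod C g" "Dom C g' = Cod C u" "g' \<cdot> u = g"
      by (rule injectiveE[OF R(2)[OF fg(4)] u(5) f(2) refl]) (use f fg in simp_all)
    obtain B where B: "direct_sum C (Cod C g) (Cod C p) B"
      using ex_direct_sum[OF Cod_closed Cod_closed] f(2) u(2) by blast
    have "\<exists>m. short_exact C (u \<cdot> f) m \<and> Cod C m = B"
      by (rule short_exact_quotient_sum[OF up fg(1,2) g'(1,3,2,4) B])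
    moreover have "Cod C (u \<cdot> f) = Cod C u" "Dom C (u \<cdot> f) = Dom C f" using fg f u by simp_all
    moreover have "B \<in> R" by (rule additive_subcat_simps(4)[OF R(1) fg(4) inj B])
    ultimately show ?thesis using fg(3) by metis
  next
    assume proj: "projective C (Cod C p) \<and> Cod C p \<in> Q"
    then obtain s r where bi: "is_biproduct C (Dom C u) (Cod C p) (Cod C u) u s r p"
      using short_exact_split[OF up] by blast
    note b = is_biproduct_simps[OF bi]
    have sr: "short_exact C s r" using biproduct_short_exact[OF biproduct_sym[OF bi]] .
    obtain B where B: "direct_sum C (Dom C f) (Dom C s) B"
      using ex_direct_sum[OF Dom_closed Dom_closed] f(1) b(7) by blast
    \<comment> \<open>Here \<open>r\<close> retracts the middle term onto \<open>Dom C u\<close>, so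
      \<open>u \<cdot> f\<close> lifts \<open>f\<close> along \<open>r\<close>, and the preimage of
      \<open>f\<close> is the direct sum of \<open>Dom C f\<close> and the top factor.\<close>
    have "r \<cdot> (u \<cdot> f) = Id C (Dom C u) \<cdot> f"
      by (rule reassoc[OF b(16)]) (use b f fg in simp_all)
    then have "r \<cdot> (u \<cdot> f) = f" using f fg by simp
    then have "\<exists>m. short_exact C m (g \<cdot> r) \<and> Dom C m = B"
      using short_exact_sub_sum[OF sr fg(1), of "u \<cdot> f" B] b f fg B by simp
    then obtain m where m: "short_exact C m (g \<cdot> r)" "Dom C m = B" by blast
    have "Dom C (g \<cdot> r) = Cod C u" "Cod C (g \<cdot> r) = Cod C g" using b f fg by simp_all
    moreover have "B \<in> Q"
      using additive_subcat_simps(4)[OF Q fg(3) _ B] proj b by simp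
    ultimately show ?thesis using m fg(4) short_exact_simps(3)[OF m(1)] by metis
  qed
qed

lemma right_orth_mem: "Y \<in> Obj C \<Longrightarrow> (\<And>X. X \<in> T \<Longrightarrow> hom_vanishes C X Y) \<Longrightarrow> Y \<in> right_orth C T"
  by (simp add: right_orth_def)

lemma left_orth_mem: "X \<in> Obj C \<Longrightarrow> (\<And>Y. Y \<in> T \<Longrightarrow> hom_vanishes C X Y) \<Longrightarrow> X \<in> left_orth C T"
  by (simp add: left_orth_def)

lemma simple_not_hom_vanishes: "simple C X \<Longrightarrow> \<not> hom_vanishes C X X"
  unfolding hom_vanishes_def simple_def using Id_closed zero_objectI by metis

end

theorem proposition1p12:
  fixes C :: "('o, 'm) addcat"
    and S Sminus Splus :: "'o set set"
    and Aminus Aplus A0 :: "'o set"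
  assumes "finitary_abelian_category C"
    and "finite_length_property C"
    and "S = {iso_class C X | X. simple C X}"
    and "Sminus = {iso_class C X | X. simple C X \<and> projective C X}"
    and "Splus = {iso_class C X | X. simple C X \<and> injective C X}"
    and "S = Sminus \<union> Splus" and "Sminus \<inter> Splus = {}"
    and "Aminus = Add_subcat C Sminus"
    and "Aplus = Add_subcat C Splus"
    and "A0 = {M \<in> Obj C. \<not> (\<exists>N. simple C N \<and> direct_summand C N M)}"
  shows "pentagonal_pair C Aplus Aminus \<and> pentagonal_middle C Aplus Aminus A0"
proof -
  interpret finitary_abelian_category C by fact
  define P where "P = {X. simple C X \<and> projective C X}"
  define I where "I = {X. simple C X \<and> injective C X}"
  have fin: "finite (homset C X X)" if "X \<in> Obj C" for X using finite_hom that by blast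
  have Obj: "X \<in> Obj C" if "simple C X" for X using that by (simp add: simple_def)
  have P_Obj: "P \<subseteq> Obj C" using Obj by (auto simp: P_def)
  \<comment> \<open>The hypothesis concerns classes and yields only an isomorphic \<open>Y\<close>
    in \<open>P\<close> or \<open>I\<close>; projectivity and injectivity are then transported to
    \<open>X\<close>.\<close>
  have simple_cases: "X \<in> P \<or> X \<in> I" if X: "simple C X" for X
  proof -
    have "iso_class C X \<in> Sminus \<union> Splus" using X assms(3,6) by blast
    then obtain Y where Y: "Y \<in> P \<or> Y \<in> I" "iso_class C X = iso_class C Y"
      using assms(4,5) by (auto simp: P_def I_def)
    then have "isomorphic C Y X" using iso_class_eqD Obj[OF X] by metis
    then show ?thesis
      using Y(1) X projective_isomorphic injective_isomorphic unfolding P_def I_def by blast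
  qed
  have PI: "\<not> isomorphic C X Y" if "X \<in> P" "Y \<in> I" for X Y
  proof
    assume "isomorphic C X Y"
    then have "iso_class C X = iso_class C Y" by (rule iso_class_eqI)
    then have "iso_class C X \<in> Sminus \<inter> Splus" using that assms(4,5) by (auto simp: P_def I_def)
    then show False using assms(7) by blast
  qed
  have van: "hom_vanishes C X Y" "hom_vanishes C Y X" if "X \<in> P" "Y \<in> I" for X Y
    using that PI[OF that] Schur isomorphic_sym unfolding P_def I_def by blast+
  have Am: "Aminus = Add_subcat C {iso_class C X | X. X \<in> P}" and
    Ap: "Aplus = Add_subcat C {iso_class C X | X. X \<in> I}"
    using assms(4,5,8,9) by (simp_all add: P_def I_def)
  have P_Am: "X \<in> Aminus" if "X \<in> P" for X
    using that unfolding Am by (intro mem_Add_subcat) (auto simp: P_def Obj)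
  have I_Ap: "X \<in> Aplus" if "X \<in> I" for X
    using that unfolding Ap by (intro mem_Add_subcat) (auto simp: I_def Obj)
  have add: "additive_subcat C Aminus" "additive_subcat C Aplus"
    unfolding Am Ap by (rule additive_subcat_Add_subcat)+
  have Am_proj: "Aminus \<subseteq> {X. projective C X}"
    unfolding Am
    by (rule Add_subcat_least[OF additive_subcat_projective]) (auto simp: P_def intro: projective_summand)
  have Ap_inj: "Aplus \<subseteq> {X. injective C X}"
    unfolding Ap
    by (rule Add_subcat_least[OF additive_subcat_injective]) (auto simp: I_def intro: injective_summand)
  have ext: "ext_closed C Aminus" "ext_closed C Aplus"
    using ext_closed_projective[OF add(1)] ext_closed_injective[OF add(2)] Am_proj Ap_inj by blast+
  have Am_left: "Aminus \<subseteq> left_orth C I"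
    unfolding Am by (rule Add_subcat_least[OF additive_subcat_left_orth left_orth_summand])
      (use P_Obj in \<open>auto simp: left_orth_def van\<close>)
  have Am_right: "Aminus \<subseteq> right_orth C I"
    unfolding Am by (rule Add_subcat_least[OF additive_subcat_right_orth right_orth_summand])
      (use P_Obj in \<open>auto simp: right_orth_def van\<close>)
  \<comment> \<open>Orthogonality spreads one side at a time: from \<open>P\<close> to
    \<open>Aminus\<close> against \<open>I\<close>, then from \<open>I\<close> to
    \<open>Aplus\<close> against all of \<open>Aminus\<close>.\<close>
  have Ap_right: "Aplus \<subseteq> right_orth C Aminus"
    unfolding Ap
  proof (rule Add_subcat_least[OF additive_subcat_right_orth right_orth_summand])
    fix X assume X: "X \<in> I"
    then show "X \<in> right_orth C Aminus"
      using Am_left by (intro right_orth_mem) (auto simp: left_orth_def I_def Obj)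
  qed
  have A0: "A0 = left_orth C P \<inter> right_orth C I"
  proof (intro equalityI subsetI)
    fix M assume M: "M \<in> A0"
    then have MO: "M \<in> Obj C" and no: "\<And>N. simple C N \<Longrightarrow> \<not> direct_summand C N M"
      using assms(10) by auto
    have "hom_vanishes C M N" if "N \<in> P" for N
    proof (rule ccontr)
      assume "\<not> hom_vanishes C M N"
      then obtain k s r h where "is_biproduct C (Dom C k) N M k s r h"
        using simple_projective_quotient_split \<open>N \<in> P\<close> MO unfolding P_def by blast
      then have "direct_summand C N M"
        using biproduct_sym unfolding direct_summand_def direct_sum_def by blast
      then show False using no that by (simp add: P_def)
    qed
    moreover have "hom_vanishes C N M" if "N \<in> I" for N
      using simple_injective_sub_summand[OF _ _ MO] no that unfolding I_def by blast
    ultimately show "M \<in> left_orth C P \<inter> right_orth C I"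
      using MO by (simp add: left_orth_def right_orth_def)
  next
    fix M assume M: "M \<in> left_orth C P \<inter> right_orth C I"
    \<comment> \<open>A simple summand inherits both orthogonality conditions but itself lies in
      \<open>P\<close> or \<open>I\<close>, so its identity would vanish.\<close>
    have False if N: "simple C N" "direct_summand C N M" for N
    proof -
      have "N \<in> left_orth C P" "N \<in> right_orth C I"
        using left_orth_summand[OF N(2)] right_orth_summand[OF N(2)] M by blast+
      then have "hom_vanishes C N N"
        using simple_cases[OF N(1)] by (auto simp: left_orth_def right_orth_def)
      then show False using simple_not_hom_vanishes N(1) by blast
    qed
    then show "M \<in> A0" using M assms(10) by (auto simp: left_orth_def)
  qed
  have A0_add: "additive_subcat C A0"
    using additive_subcat_Inter[of "{left_orth C P, right_orth C I}"]
      additive_subcat_left_orth additive_subcat_right_orth unfolding A0 by auto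
  have A0_ext: "ext_closed C A0"
    using ext_closed_left_orth[of P] ext_closed_right_orth[of I] unfolding A0 ext_closed_def by blast
  have Am_A0: "Aminus \<subseteq> right_orth C A0"
    unfolding Am
  proof (rule Add_subcat_least[OF additive_subcat_right_orth right_orth_summand])
    fix X assume "X \<in> P"
    then show "X \<in> right_orth C A0"
      unfolding A0 by (intro right_orth_mem) (auto simp: left_orth_def P_def Obj)
  qed
  \<comment> \<open>\<open>G\<close> is in fact the right orthogonal of \<open>I\<close>:
    \<open>G_right\<close> gives one inclusion, and \<open>right_split\<close> with closure under
    extensions gives the other.\<close>
  define G where "G = ext_generated C Aminus A0"
  have G_right: "G \<subseteq> right_orth C I"
    unfolding G_def using Am_right A0
    by (intro ext_generated_least additive_subcat_right_orth ext_closed_right_orth) auto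
  have G_up: "Aminus \<subseteq> G" "A0 \<subseteq> G" unfolding G_def by (rule ext_generated_upper)+
  have G_ext: "ext_closed C G" unfolding G_def by (rule ext_closed_ext_generated)
  have G_add: "additive_subcat C G"
    unfolding G_def using add(1) A0_add
    by (intro additive_subcat_ext_generated additive_subcat_simps(1))
  have Ap_left: "Aplus \<subseteq> left_orth C G"
    unfolding Ap
  proof (rule Add_subcat_least[OF additive_subcat_left_orth left_orth_summand])
    fix X assume "X \<in> I"
    then show "X \<in> left_orth C G"
      using G_right by (intro left_orth_mem) (auto simp: right_orth_def I_def Obj)
  qed
  have right_split: "\<exists>f g. short_exact C f g \<and> Cod C f = M \<and> Dom C f \<in> A0 \<and> Cod C g \<in> Aminus"
    if M: "M \<in> right_orth C I" for M
  proof -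
    have "\<exists>f g. short_exact C f g \<and> Cod C f = M \<and> Dom C f \<in> left_orth C P \<and> Cod C g \<in> Aminus"
      using M P_Am by (intro left_orth_decomposition add fin) (auto simp: P_def right_orth_def)
    then obtain f g where fg: "short_exact C f g" "Cod C f = M" "Dom C f \<in> left_orth C P"
      "Cod C g \<in> Aminus" by blast
    \<comment> \<open>The right orthogonal passes to subobjects, so removing the projective simples
      keeps the condition on \<open>I\<close> and lands in \<open>A0\<close>.\<close>
    have "Dom C f \<in> right_orth C I"
      using right_orth_subobject short_exact_simps(5)[OF fg(1)] fg(2) M by blast
    then show ?thesis using fg A0 by blast
  qed
  have pair: "factorizing_pair C (Obj C) Aplus Aminus"
  proof (rule factorizing_pairI[OF additive_subcat_Obj ext_closed_Obj add(2) ext(2) _ add(1) ext(1)])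
    fix M assume "M \<in> Obj C"
    then obtain n i where "composition_series C M n i"
      using assms(2) unfolding finite_length_property_def by blast
    then show "\<exists>i p. short_exact C i p \<and> Cod C i = M \<and> Dom C i \<in> Aminus \<and> Cod C p \<in> Aplus"
      using simple_cases P_Am I_Ap Ap_inj
      by (intro projective_injective_filtration[OF add]) (auto simp: P_def)
  next
    fix X Y assume "X \<in> Aminus" "Y \<in> Aplus"
    then show "hom_vanishes C X Y" using Ap_right by (auto simp: right_orth_def)
  qed (use add additive_subcat_simps(1) in blast)+
  have pair1: "factorizing_pair C G Aminus A0"
  proof (rule factorizing_pairI[OF G_add G_ext add(1) ext(1) G_up(1) A0_add A0_ext G_up(2)])
    fix X Y assume "X \<in> A0" "Y \<in> Aminus"
    then show "hom_vanishes C X Y" using Am_A0 by (auto simp: right_orth_def)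
  next
    fix M assume "M \<in> G"
    then show "\<exists>i p. short_exact C i p \<and> Cod C i = M \<and> Dom C i \<in> A0 \<and> Cod C p \<in> Aminus"
      using right_split G_right by blast
  qed
  have pair2: "factorizing_pair C (Obj C) G Aplus"
  proof (rule factorizing_pairI[OF additive_subcat_Obj ext_closed_Obj G_add G_ext _ add(2) ext(2)])
    fix X Y assume "X \<in> Aplus" "Y \<in> G"
    then show "hom_vanishes C X Y" using Ap_left by (auto simp: left_orth_def)
  next
    fix M assume "M \<in> Obj C"
    then have "\<exists>f g. short_exact C f g \<and> Cod C f = M \<and> Dom C f \<in> Aplus \<and> Cod C g \<in> right_orth C I"
      using I_Ap by (intro right_orth_decomposition add fin) (auto simp: I_def)
    then obtain f g where fg: "short_exact C f g" "Cod C f = M" "Dom C f \<in> Aplus"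
      "Cod C g \<in> right_orth C I" by blast
    \<comment> \<open>The quotient is orthogonal to \<open>I\<close>; to see that it lies in
      \<open>G\<close> it is written as an extension of an object of \<open>Aminus\<close> by one of
      \<open>A0\<close>.\<close>
    obtain f' g' where "short_exact C f' g'" "Cod C f' = Cod C g" "Dom C f' \<in> A0" "Cod C g' \<in> Aminus"
      using right_split[OF fg(4)] by blast
    then have "Cod C g \<in> G" using ext_closedD[OF G_ext, of f' g'] G_up by auto
    then show "\<exists>i p. short_exact C i p \<and> Cod C i = M \<and> Dom C i \<in> Aplus \<and> Cod C p \<in> G"
      using fg by blast
  qed (use add G_add additive_subcat_simps(1) in blast)+
  have "pentagonal_middle C Aplus Aminus A0"
    using A0_add A0_ext pair1 pair2 by (simp add: pentagonal_middle_def factorizing_triple_def G_def)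
  then show ?thesis using pair unfolding pentagonal_pair_def by blast
qed

end
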